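(* Let $n\ge 3$, set $y_1=\dots=y_n=0$, and let $w\in\operatorname{St}(n)$. Then the renormalized steady state probability $\psi_w$ is a polynomial in $x_1,\dots,x_n$, and the largest monomial $\eta(w)$ (with coefficient $1$) dividing $\psi_w$ is $$\eta(w)=\prod_{i=1}^{n-2}x_i^{\,a_i(w)+a_{i+1}(w)+\cdots+a_{n-2}(w)}.$$
   Context: Inhomogeneous TASEP with $y_i=0$: the state space $\operatorname{St}(n)$ consists of the $n!$ labelings of $n$ sites arranged in a ring by distinct numbers $1,\dots,n$, identified with permutations $w=(w_1,\dots,w_n)\in S_n$ (read around the ring, with $w_n$ adjacent to $w_1$). It is a continuous-time Markov chain in which two adjacent particles, $i$ on the left and $j$ on the right (including the pair $w_n,w_1$), swap with rate $x_i$ if $i<j$ and rate $0$ otherwise. The renormalized steady state probabilities $\psi_w$ are the stationary probabilities all multiplied by the common constant chosen so that $\psi_{12\cdots n}=\prod_{1\le i<j\le n}x_i^{j-i-1}$. For $1\le i\le n-2$, $a_i(w)$ is the number of letters greater than $i+1$ among the letters strictly between $i+1$ and $i$ when $w$ is read cyclically to the right (clockwise around the ring) starting at $i+1$ and stopping at $i$. (E.g. for $w=12345$: $a_1=3,a_2=2,a_3=1$.) *)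

theory Defs
  imports Complex_Main
begin

text \<open>States: St(n) = permutations of 1..n, as lists read around the ring
  (position k is adjacent to position (k+1) mod n).\<close>
definition St :: "nat \<Rightarrow> nat list set" where
  "St n = {w. length w = n \<and> distinct w \<and> set w = {1..n}}"

definition nxt :: "nat \<Rightarrow> nat \<Rightarrow> nat" where
  "nxt n k = (k + 1) mod n"

definition swap_at :: "nat \<Rightarrow> nat list \<Rightarrow> nat \<Rightarrow> nat list" where
  "swap_at n w k = w[k := w ! nxt n k, nxt n k := w ! k]"

definition out_rate :: "nat \<Rightarrow> (nat \<Rightarrow> real) \<Rightarrow> nat list \<Rightarrow> real" where
  "out_rate n x w = (\<Sum>k<n. if w ! k < w ! nxt n k then x (w ! k) else 0)"

definition trans_rate :: "nat \<Rightarrow> (nat \<Rightarrow> real) \<Rightarrow> nat list \<Rightarrow> nat list \<Rightarrow> real" where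
  "trans_rate n x v w =
     (\<Sum>k<n. if v ! k < v ! nxt n k \<and> swap_at n v k = w then x (v ! k) else 0)"

text \<open>Stationary distribution of the inhomogeneous TASEP with y_i = 0.\<close>
definition stationary :: "nat \<Rightarrow> (nat \<Rightarrow> real) \<Rightarrow> (nat list \<Rightarrow> real) \<Rightarrow> bool" where
  "stationary n x \<pi> \<longleftrightarrow>
     (\<forall>w\<in>St n. \<pi> w \<ge> 0) \<and> (\<Sum>w\<in>St n. \<pi> w) = 1 \<and>
     (\<forall>w\<in>St n. \<pi> w * out_rate n x w = (\<Sum>v\<in>St n. \<pi> v * trans_rate n x v w))"

definition psi_id :: "nat \<Rightarrow> (nat \<Rightarrow> real) \<Rightarrow> real" where
  "psi_id n x = (\<Prod>j\<in>{1..n}. \<Prod>i\<in>{1..<j}. x i ^ (j - i - 1))"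

definition psi :: "nat \<Rightarrow> (nat \<Rightarrow> real) \<Rightarrow> (nat list \<Rightarrow> real) \<Rightarrow> nat list \<Rightarrow> real" where
  "psi n x \<pi> w = \<pi> w * (psi_id n x / \<pi> [1..<n+1])"

definition pos :: "nat list \<Rightarrow> nat \<Rightarrow> nat" where
  "pos w m = (THE k. k < length w \<and> w ! k = m)"

definition a_stat :: "nat \<Rightarrow> nat list \<Rightarrow> nat \<Rightarrow> nat" where
  "a_stat n w i = card {d. 0 < d \<and> d < (pos w i + n - pos w (i+1)) mod n \<and>
                          w ! ((pos w (i+1) + d) mod n) > i + 1}"

definition eta :: "nat \<Rightarrow> nat list \<Rightarrow> nat \<Rightarrow> nat" where
  "eta n w i = (if 1 \<le> i \<and> i \<le> n - 2 then (\<Sum>j\<in>{i..n-2}. a_stat n w j) else 0)"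

text \<open>Polynomials in x_1..x_n with real coefficients: finitely supported coefficient
  functions on exponent vectors.\<close>
definition is_poly :: "nat \<Rightarrow> ((nat \<Rightarrow> nat) \<Rightarrow> real) \<Rightarrow> bool" where
  "is_poly n c \<longleftrightarrow> finite {\<alpha>. c \<alpha> \<noteq> 0} \<and>
     (\<forall>\<alpha>. c \<alpha> \<noteq> 0 \<longrightarrow> (\<forall>k. k \<notin> {1..n} \<longrightarrow> \<alpha> k = 0))"

definition poly_eval :: "nat \<Rightarrow> ((nat \<Rightarrow> nat) \<Rightarrow> real) \<Rightarrow> (nat \<Rightarrow> real) \<Rightarrow> real" where
  "poly_eval n c x = (\<Sum>\<alpha>\<in>{\<alpha>. c \<alpha> \<noteq> 0}. c \<alpha> * (\<Prod>k\<in>{1..n}. x k ^ \<alpha> k))"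

definition mono_dvd :: "(nat \<Rightarrow> nat) \<Rightarrow> ((nat \<Rightarrow> nat) \<Rightarrow> real) \<Rightarrow> bool" where
  "mono_dvd \<alpha> c \<longleftrightarrow> (\<forall>\<beta>. c \<beta> \<noteq> 0 \<longrightarrow> (\<forall>k. \<alpha> k \<le> \<beta> k))"

definition largest_mono_dvd :: "(nat \<Rightarrow> nat) \<Rightarrow> ((nat \<Rightarrow> nat) \<Rightarrow> real) \<Rightarrow> bool" where
  "largest_mono_dvd \<eta> c \<longleftrightarrow> mono_dvd \<eta> c \<and>
     (\<forall>\<alpha>. mono_dvd \<alpha> c \<longrightarrow> (\<forall>k. \<alpha> k \<le> \<eta> k))"

end

theory Submission
  imports Defs "HOL-Library.Multiset"
begin

text \<open>
  The steady state is built from Ferrari--Martin multiline queues. At level \<open>r\<close> one considers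
  words on the ring with the letters \<open>1, \<dots>, r\<close> once each and all other sites carrying a hole
  \<open>r + 1\<close>. A word \<open>u\<close> of level \<open>r - 1\<close> and a word \<open>w\<close> of level \<open>r\<close> are linked when \<open>w\<close> is
  the output of a priority queue fed by \<open>u\<close> and read from right to left: each non-hole site of
  \<open>w\<close> serves the smallest waiting class, class \<open>r\<close> being in infinite supply; a hole passed while
  \<open>m\<close> is the smallest waiting class has weight \<open>1 / x_m\<close>. These link weights intertwine the two
  generators, because on two neighbouring sites the commutator is a difference of boundary terms
  (the ``hat'' operators) and therefore telescopes. Multiplying each hole by \<open>x_1 \<cdots> x_r\<close> turns
  the weights into monomials, so the steady state is a sum of monomials with coefficient 1 over
  all chains of links; it is unique up to scaling by a Dirichlet form argument.

  As no cancellation occurs, the largest monomial divisor is the componentwise minimum of the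
  exponents. It is computed one level at a time by deleting the smallest class \<open>c\<close> from \<open>u\<close> and
  \<open>w\<close>: \<open>c\<close> travels over a run of consecutive holes of \<open>w\<close>, and moving it there changes the
  walk \<open>r, r - 1, \<dots>, k\<close> around the ring by an amount that the number of holes compensates.
\<close>

text \<open>The exponent of each \<open>x_k\<close> is minimised on its own: a monomial dividing all
  terms is bounded in each variable separately, so the chains attaining the minimum for different
  \<open>k\<close> need not coincide. For fixed \<open>k\<close> the claim is a recursion over
  levels: \<open>legs k r w\<close> is the minimum, over the words \<open>u\<close> linked to
  \<open>w\<close>, of \<open>legs k (r - 1) u\<close> plus the number of holes whose recorded class
  is not \<open>k\<close>. Deleting the smallest class produces lines whose letters start above 1,
  so this recursion is proved for lines with an arbitrary smallest letter. That the minimum is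
  attained also shows that every state has at least one term; this gives the positivity that the
  Dirichlet form argument needs. The normalisation is fixed at the identity because that word admits
  exactly one chain of links, so its value is a single monomial.\<close>

section \<open>The priority queue and its local commutation relation\<close>

text \<open>The queue holds waiting classes below \<open>r\<close>; inserting \<open>r\<close> in \<open>front\<close> models the infinite
  supply of class \<open>r\<close>, and a top letter \<open>r\<close> (a hole of the upper word) adds nothing.\<close>
definition front :: "nat \<Rightarrow> nat multiset \<Rightarrow> nat" where
  "front r Q = Min (insert r (set_mset Q))"

definition arrive :: "nat \<Rightarrow> nat \<Rightarrow> nat multiset \<Rightarrow> nat multiset" where
  "arrive r u Q = (if u < r then add_mset u Q else Q)"

definition queue_ok :: "nat \<Rightarrow> nat multiset \<Rightarrow> bool" where
  "queue_ok r Q \<longleftrightarrow> set_mset Q \<subseteq> {1..<r}"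

lemma front_empty [simp]: "front r {#} = r"
  by (simp add: front_def)

lemma front_le: "front r Q \<le> r"
  by (simp add: front_def)

lemma front_ge_1: "queue_ok r Q \<Longrightarrow> 1 \<le> r \<Longrightarrow> 1 \<le> front r Q"
  by (auto simp: front_def queue_ok_def)

lemma front_arrive: "u \<le> r \<Longrightarrow> front r (arrive r u Q) = min u (front r Q)"
proof -
  assume "u \<le> r"
  have "Min (insert r (insert u (set_mset Q))) = min u (Min (insert r (set_mset Q)))"
    by (subst insert_commute) simp
  then show ?thesis
    using \<open>u \<le> r\<close> front_le[of r Q] by (auto simp: front_def arrive_def)
qed

lemma arrive_commute: "arrive r u (arrive r v Q) = arrive r v (arrive r u Q)"
  by (auto simp: arrive_def)

lemma front_not_in: "queue_ok r Q \<Longrightarrow> r \<notin># Q"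
  by (auto simp: queue_ok_def)

text \<open>A class arriving in front is served at once. For \<open>u = r\<close> nothing is added
  and nothing removed, because \<open>r\<close> is never stored.\<close>

lemma arrive_diff_self:
  "queue_ok r Q \<Longrightarrow> u \<le> front r Q \<Longrightarrow> arrive r u Q - {#u#} = Q"
  using front_le[of r Q] front_not_in[of r Q]
  by (cases u r rule: linorder_cases) (auto simp: arrive_def diff_single_trivial)

lemma arrive_diff_front:
  "front r Q < u \<Longrightarrow> arrive r u Q - {#front r Q#} = arrive r u (Q - {#front r Q#})"
  by (auto simp: arrive_def)

lemma front_diff: "front r Q \<le> front r (Q - {#m#})"
  unfolding front_def by (rule Min_antimono) (auto dest: in_diffD)

lemma queue_ok_arrive: "queue_ok r Q \<Longrightarrow> 1 \<le> u \<Longrightarrow> queue_ok r (arrive r u Q)"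
  by (auto simp: queue_ok_def arrive_def)

lemma queue_ok_diff: "queue_ok r Q \<Longrightarrow> queue_ok r (Q - M)"
  unfolding queue_ok_def by (auto dest: in_diffD)

lemma queue_ok_empty [simp]: "queue_ok r {#}"
  by (simp add: queue_ok_def)

text \<open>Sites are processed from the right end. The result is the final queue together with the
  multiset of front classes recorded at the holes of the bottom word.\<close>
fun run :: "nat \<Rightarrow> nat list \<Rightarrow> nat list \<Rightarrow> nat multiset \<Rightarrow> (nat multiset \<times> nat multiset) option" where
  "run r [] [] Q = Some (Q, {#})"
| "run r (w # ws) (u # us) Q =
     (case run r ws us Q of None \<Rightarrow> None
      | Some (Q1, M) \<Rightarrow>
         (let R = arrive r u Q1; m = front r R in
          if w = Suc r then Some (R, add_mset m M)
          else if w = m then Some (R - {#m#}, M) else None))"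
| "run r _ _ Q = None"

definition weight :: "(nat \<Rightarrow> real) \<Rightarrow> nat multiset \<Rightarrow> real" where
  "weight x M = (\<Prod>m\<in>#M. inverse (x m))"

definition run_sum where
  "run_sum x r ws us \<kappa> Q =
     (case run r ws us Q of None \<Rightarrow> 0 | Some (Q', M) \<Rightarrow> weight x M * \<kappa> Q')"

text \<open>Operators act on observables \<open>\<kappa>\<close> of the final queue, so that reading a word from the left
  matches processing its sites from the right.\<close>
definition site :: "(nat \<Rightarrow> real) \<Rightarrow> nat \<Rightarrow> nat \<Rightarrow> nat \<Rightarrow> (nat multiset \<Rightarrow> real) \<Rightarrow> nat multiset \<Rightarrow> real" where
  "site x r w u \<kappa> Q =
     (let R = arrive r u Q; m = front r R in
      if w = Suc r then inverse (x m) * \<kappa> R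
      else if w = m then \<kappa> (R - {#m#}) else 0)"

text \<open>The hole entry of \<open>site\<close> stripped of its factor \<open>1 / x_m\<close> and
  negated. With this choice the commutator in \<open>local_relation\<close> is a difference of
  boundary terms.\<close>

definition site_hat :: "nat \<Rightarrow> nat \<Rightarrow> nat \<Rightarrow> (nat multiset \<Rightarrow> real) \<Rightarrow> nat multiset \<Rightarrow> real" where
  "site_hat r w u \<kappa> Q = (if w = Suc r then - \<kappa> (arrive r u Q) else 0)"

lemma run_sum_Nil [simp]: "run_sum x r [] [] \<kappa> Q = \<kappa> Q"
  by (simp add: run_sum_def weight_def)

lemma run_sum_Cons [simp]:
  "run_sum x r (w # ws) (u # us) \<kappa> Q = run_sum x r ws us (site x r w u \<kappa>) Q"
  by (auto simp: run_sum_def site_def weight_def Let_def split: option.splits)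

lemma run_sum_append:
  "length ws = length us \<Longrightarrow>
   run_sum x r (ws @ ws') (us @ us') \<kappa> = run_sum x r ws' us' (run_sum x r ws us \<kappa>)"
proof (induction ws us arbitrary: \<kappa> rule: list_induct2)
  case Nil
  have "run_sum x r [] [] \<kappa> = \<kappa>" by (rule ext) simp
  then show ?case by simp
next
  case (Cons w ws u us)
  have "run_sum x r (w # ws) (u # us) \<kappa> = run_sum x r ws us (site x r w u \<kappa>)"
    by (rule ext) simp
  moreover have "run_sum x r (w # ws @ ws') (u # us @ us') \<kappa>
      = run_sum x r (ws @ ws') (us @ us') (site x r w u \<kappa>)"
    by (rule ext) simp
  ultimately show ?case using Cons by simp
qed

lemma run_sum_diff:
  "run_sum x r ws us (\<lambda>Q. f Q - g Q) Q = run_sum x r ws us f Q - run_sum x r ws us g Q"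
  by (auto simp: run_sum_def algebra_simps split: option.splits)

lemma run_sum_cmult:
  "run_sum x r ws us (\<lambda>Q. c * f Q) Q = c * run_sum x r ws us f Q"
  by (auto simp: run_sum_def algebra_simps split: option.splits)

lemma run_sum_zero [simp]: "run_sum x r ws us (\<lambda>Q. 0) Q = 0"
  by (auto simp: run_sum_def split: option.splits)

lemma run_sum_if:
  "run_sum x r ws us (\<lambda>Q. if b then f Q else g Q) Q = (if b then run_sum x r ws us f Q else run_sum x r ws us g Q)"
  by auto

lemma site_ok_cong:
  assumes "queue_ok r Q" "1 \<le> u" "\<And>Q. queue_ok r Q \<Longrightarrow> f Q = g Q"
  shows "site x r w u f Q = site x r w u g Q"
  using assms by (auto simp: site_def Let_def queue_ok_arrive queue_ok_diff)

lemma run_sum_ok_cong: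
  assumes "length ws = length us" "queue_ok r Q" "set us \<subseteq> {1..}" "\<And>Q. queue_ok r Q \<Longrightarrow> f Q = g Q"
  shows "run_sum x r ws us f Q = run_sum x r ws us g Q"
  using assms
proof (induction ws us arbitrary: f g rule: list_induct2)
  case (Cons w ws u us)
  show ?case unfolding run_sum_Cons
    by (rule Cons.IH) (use Cons.prems in \<open>auto intro: site_ok_cong\<close>)
qed auto

text \<open>The neighbours are \<open>a\<close>, \<open>b\<close> in the bottom word and
  \<open>k\<close>, \<open>l\<close> above them; the right site is processed first. Let
  \<open>m\<close> be the front once \<open>l\<close> has arrived. Exchanging the arrivals matters
  only if \<open>k < m\<close>, when \<open>k\<close> overtakes everything waiting; otherwise the
  top term vanishes.\<close>

lemma local_relation:
  assumes ok: "queue_ok r Q" and r: "1 \<le> r" and x: "\<forall>i\<in>{1..r}. x i \<noteq> (0::real)"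
    and a: "a \<le> Suc r" and b: "b \<le> Suc r" and k: "1 \<le> k" "k \<le> r" and l: "1 \<le> l" "l \<le> r"
  shows "(if b < a then x b * site x r a l (site x r b k \<kappa>) Q else 0)
       - (if a < b then x a * site x r b l (site x r a k \<kappa>) Q else 0)
       - (if k < l then x k * (site x r b k (site x r a l \<kappa>) Q - site x r b l (site x r a k \<kappa>) Q) else 0)
       = site_hat r b l (site x r a k \<kappa>) Q - site x r b l (site_hat r a k \<kappa>) Q"
proof -
  define R where "R = arrive r l Q"
  define m where "m = front r R"
  define R1 where "R1 = R - {#m#}"
  define m2 where "m2 = front r R1"
  have okR: "queue_ok r R" using ok l by (auto simp: R_def queue_ok_arrive)
  have okR1: "queue_ok r R1" using okR by (auto simp: R1_def queue_ok_diff)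
  have m: "1 \<le> m" "m \<le> r" "m \<le> m2" "m2 \<le> r"
    using front_ge_1[OF okR r] front_le[of r R] front_diff[of r R m] front_le[of r R1] by (auto simp: m_def m2_def R1_def)
  have xm: "x m \<noteq> 0" "x m2 \<noteq> 0" "x k \<noteq> 0" using x m k by auto
  have site2: "site x r b l f Q = (if b = Suc r then inverse (x m) * f R else if b = m then f R1 else 0)" for f b
    by (simp add: site_def Let_def R_def[symmetric] m_def[symmetric] R1_def[symmetric])
  have hat2: "site_hat r b l f Q = (if b = Suc r then - f R else 0)" for f b
    by (simp add: site_hat_def R_def[symmetric])
  show ?thesis
  proof (cases "m \<le> k")
    case True
    define R2 where "R2 = arrive r k R1"
    define m3 where "m3 = min k m2"
    have fR: "front r (arrive r k R) = m" using front_arrive[of k r R] k True by (simp add: m_def)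
    have fR1: "front r (arrive r k R1) = m3" using front_arrive[of k r R1] k by (simp add: m2_def m3_def)
    have m3: "m \<le> m3" "m3 \<le> r" "x m3 \<noteq> 0" using True m k x by (auto simp: m3_def min_def)
    have dif: "arrive r k R - {#m#} = R2"
    proof (cases "m = k")
      case True
      have "arrive r m R - {#m#} = R" using okR by (intro arrive_diff_self) (auto simp: m_def)
      moreover have "arrive r m R1 = R"
      proof (cases "m < r")
        case True
        then have "m \<in># R" using Min_in[of "insert r (set_mset R)"] by (auto simp: m_def front_def)
        then show ?thesis using True by (simp add: arrive_def R1_def)
      next
        case False
        then show ?thesis using m front_not_in[OF okR] by (simp add: arrive_def R1_def)
      qed
      ultimately show ?thesis using True by (simp add: R2_def)
    next
      case False
      then show ?thesis using arrive_diff_front[of r R k] True by (simp add: m_def R1_def R2_def)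
    qed
    have s1R: "site x r a k \<kappa> R = (if a = Suc r then inverse (x m) * \<kappa> (arrive r k R) else if a = m then \<kappa> R2 else 0)" for a
      by (simp add: site_def Let_def fR dif)
    have s1R1: "site x r a k \<kappa> R1 = (if a = Suc r then inverse (x m3) * \<kappa> R2 else if a = m3 then \<kappa> (R2 - {#m3#}) else 0)" for a
      by (simp add: site_def Let_def fR1 R2_def)
    \<comment> \<open>For \<open>m \<le> k < l\<close> the arrival \<open>l\<close> is not the
      front, so \<open>m\<close> was already the front of \<open>Q\<close> and the two arrivals can
      be exchanged.\<close>
    have swap: "k < l \<Longrightarrow> site x r b k (site x r a l \<kappa>) Q = site x r b l (site x r a k \<kappa>) Q"
    proof -
      assume kl: "k < l"
      have fQ: "front r Q = m" using front_arrive[of l r Q] l kl True by (auto simp: m_def R_def min_def split: if_splits)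
      have 1: "front r (arrive r k Q) = m" using front_arrive[of k r Q] k True fQ by simp
      have 2: "front r (arrive r l (arrive r k Q)) = m" using fR by (metis arrive_commute R_def)
      have 3: "arrive r l (arrive r k Q) = arrive r k R" by (metis arrive_commute R_def)
      have R1': "R1 = arrive r l (Q - {#m#})" using arrive_diff_front[of r Q l] fQ True kl by (simp add: R1_def R_def)
      have 4: "arrive r l (arrive r k Q - {#m#}) = R2"
      proof -
        have "arrive r k Q - {#m#} = arrive r k (Q - {#m#})"
        proof (cases "m = k")
          case True
          then have "m < r" using kl l by simp
          then have "m \<in># Q" using Min_in[of "insert r (set_mset Q)"] fQ by (auto simp: front_def)
          then show ?thesis using True \<open>m < r\<close> by (simp add: arrive_def)
        next
          case False
          then show ?thesis using arrive_diff_front[of r Q k] fQ True by simp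
        qed
        then show ?thesis by (metis R1' R2_def arrive_commute)
      qed
      have 5: "front r R2 = m3" by (simp add: R2_def fR1)
      show ?thesis
        unfolding site_def Let_def R_def[symmetric] m_def[symmetric] R1_def[symmetric] 1 3 fR 4 5 dif fR1 R2_def[symmetric]
        by simp
    qed
    show ?thesis
      using swap m m3 xm a b unfolding site2 hat2 s1R s1R1
      unfolding site_hat_def R2_def
      by (auto simp: field_simps)
  next
    case False
    then have km: "k < m" by simp
    have fR: "front r (arrive r k R) = k" using front_arrive[of k r R] k km by (simp add: m_def)
    have fR1: "front r (arrive r k R1) = k" using front_arrive[of k r R1] k km m by (simp add: m2_def)
    have dR: "arrive r k R - {#k#} = R" using okR km by (intro arrive_diff_self) (auto simp: m_def)
    have dR1: "arrive r k R1 - {#k#} = R1" using okR1 km m by (intro arrive_diff_self) (auto simp: m2_def)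
    have s1R: "site x r a k \<kappa> R = (if a = Suc r then inverse (x k) * \<kappa> (arrive r k R) else if a = k then \<kappa> R else 0)" for a
      by (simp add: site_def Let_def fR dR)
    have s1R1: "site x r a k \<kappa> R1 = (if a = Suc r then inverse (x k) * \<kappa> (arrive r k R1) else if a = k then \<kappa> R1 else 0)" for a
      by (simp add: site_def Let_def fR1 dR1)
    have swap: "site x r b k (site x r a l \<kappa>) Q =
       (if b = Suc r then inverse (x k) * (if a = Suc r then inverse (x k) * \<kappa> (arrive r k R) else if a = k then \<kappa> R else 0)
        else if b = k then (if a = Suc r then inverse (x m) * \<kappa> R else if a = m then \<kappa> R1 else 0) else 0)"
    proof -
      have fQ: "m \<le> front r Q" using front_arrive[of l r Q] l  by (auto simp: m_def R_def)
      have 1: "front r (arrive r k Q) = k" using front_arrive[of k r Q] k km fQ by simp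
      have 2: "arrive r k Q - {#k#} = Q" using ok km fQ by (intro arrive_diff_self) auto
      have 3: "arrive r l (arrive r k Q) = arrive r k R" by (metis arrive_commute R_def)
      show ?thesis
        using k m by (simp add: site_def Let_def 1 2 3 fR dR R_def[symmetric] m_def[symmetric] R1_def[symmetric])
    qed
    \<comment> \<open>The front \<open>m\<close> is at most the newly arrived \<open>l\<close>, so
      the top swap is always active in this case.\<close>
    have "k < l" using km front_arrive[of l r Q] l by (auto simp: m_def R_def)
    then show ?thesis
      unfolding swap site2 hat2 s1R s1R1 unfolding site_hat_def using m xm a b km
      by (auto simp: field_simps)
  qed
qed

section \<open>The intertwining relation on the ring\<close>

text \<open>Only the bonds inside an open segment are counted; the bond closing the ring is split
  off in \<open>gen_bottom_split\<close>. Absorbing the head into \<open>F\<close> makes the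
  recursion follow that of \<open>run_sum\<close>.\<close>

fun chain_bottom :: "(nat \<Rightarrow> real) \<Rightarrow> (nat list \<Rightarrow> real) \<Rightarrow> nat list \<Rightarrow> real" where
  "chain_bottom x F (a # b # l) =
     (if b < a then x b * F (b # a # l) else 0) - (if a < b then x a * F (a # b # l) else 0)
     + chain_bottom x (\<lambda>l. F (a # l)) (b # l)"
| "chain_bottom x F _ = 0"

fun chain_top :: "(nat \<Rightarrow> real) \<Rightarrow> (nat list \<Rightarrow> real) \<Rightarrow> nat list \<Rightarrow> real" where
  "chain_top x F (a # b # l) =
     (if a < b then x a * (F (b # a # l) - F (a # b # l)) else 0)
     + chain_top x (\<lambda>l. F (a # l)) (b # l)"
| "chain_top x F _ = 0"

text \<open>Sum of \<open>local_relation\<close> over all bonds: the hat at an inner site occurs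
  with plus for the bond on its left and with minus for the bond on its right, so only the two ends
  survive.\<close>

lemma chain_telescope:
  assumes "length ws = length us" "ws \<noteq> []" "set ws \<subseteq> {..Suc r}" "set us \<subseteq> {1..r}"
    and "1 \<le> r" "\<forall>i\<in>{1..r}. x i \<noteq> (0::real)" "queue_ok r Q"
  shows "chain_bottom x (\<lambda>v. run_sum x r v us \<kappa> Q) ws - chain_top x (\<lambda>v. run_sum x r ws v \<kappa> Q) us
    = site_hat r (last ws) (last us) (run_sum x r (butlast ws) (butlast us) \<kappa>) Q
      - run_sum x r (tl ws) (tl us) (site_hat r (hd ws) (hd us) \<kappa>) Q"
  using assms
proof (induction ws us arbitrary: \<kappa> rule: list_induct2)
  case (Cons a ws k us)
  show ?case
  proof (cases ws)
    case Nil
    have "run_sum x r [] [] \<kappa> = \<kappa>" by (rule ext) simp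
    then show ?thesis using Nil Cons by simp
  next
    case w: (Cons b ws')
    then obtain l us' where u: "us = l # us'" using Cons.hyps by (cases us) auto
    let ?D = "\<lambda>Q. (if b < a then x b * site x r a l (site x r b k \<kappa>) Q else 0)
       - (if a < b then x a * site x r b l (site x r a k \<kappa>) Q else 0)
       - (if k < l then x k * (site x r b k (site x r a l \<kappa>) Q - site x r b l (site x r a k \<kappa>) Q) else 0)"
    have IH: "chain_bottom x (\<lambda>v. run_sum x r v us (site x r a k \<kappa>) Q) ws
         - chain_top x (\<lambda>v. run_sum x r ws v (site x r a k \<kappa>) Q) us
      = site_hat r (last ws) (last us) (run_sum x r (butlast ws) (butlast us) (site x r a k \<kappa>)) Q
      - run_sum x r ws' us' (site_hat r b l (site x r a k \<kappa>)) Q"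
      using Cons.IH[of "site x r a k \<kappa>"] Cons.prems w u by simp
    have split: "chain_bottom x (\<lambda>v. run_sum x r v (k # us) \<kappa> Q) (a # ws) - chain_top x (\<lambda>v. run_sum x r (a # ws) v \<kappa> Q) (k # us)
      = run_sum x r ws' us' ?D Q
       + (chain_bottom x (\<lambda>v. run_sum x r v us (site x r a k \<kappa>) Q) ws
         - chain_top x (\<lambda>v. run_sum x r ws v (site x r a k \<kappa>) Q) us)"
      unfolding w u run_sum_diff run_sum_if run_sum_cmult run_sum_zero chain_bottom.simps chain_top.simps run_sum_Cons
      by linarith
    \<comment> \<open>The sites further right are processed earlier and hand over only queues with
      classes in \<open>{1..<r}\<close>, where the local relation applies.\<close>
    have local: "run_sum x r ws' us' ?D Q =
        run_sum x r ws' us' (\<lambda>Q. site_hat r b l (site x r a k \<kappa>) Q - site x r b l (site_hat r a k \<kappa>) Q) Q"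
    proof (rule run_sum_ok_cong)
      fix Q assume "queue_ok r Q"
      then show "?D Q = site_hat r b l (site x r a k \<kappa>) Q - site x r b l (site_hat r a k \<kappa>) Q"
        by (rule local_relation) (use Cons.prems w u in auto)
    qed (use Cons.prems Cons.hyps w u in auto)
    have tail: "run_sum x r ws us (site_hat r a k \<kappa>) Q = run_sum x r ws' us' (site x r b l (site_hat r a k \<kappa>)) Q"
      by (simp add: w u)
    have init: "run_sum x r (butlast ws) (butlast us) (site x r a k \<kappa>) = run_sum x r (butlast (a # ws)) (butlast (k # us)) \<kappa>"
      by (rule ext) (simp add: w u)
    have ends: "last (a # ws) = last ws" "last (k # us) = last us" by (simp_all add: w u)
    have "run_sum x r ws' us' ?D Q = run_sum x r ws' us' (site_hat r b l (site x r a k \<kappa>)) Q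
        - run_sum x r ws us (site_hat r a k \<kappa>) Q"
      unfolding local unfolding run_sum_diff tail ..
    then show ?thesis
      using split IH unfolding ends list.sel init by linarith
  qed
qed auto

section \<open>Generators on the ring and their rotation invariance\<close>

definition gen_bottom :: "(nat \<Rightarrow> real) \<Rightarrow> nat \<Rightarrow> (nat list \<Rightarrow> real) \<Rightarrow> nat list \<Rightarrow> real" where
  "gen_bottom x n F w = (\<Sum>k<n.
     (if w ! nxt n k < w ! k then x (w ! nxt n k) * F (swap_at n w k) else 0)
     - (if w ! k < w ! nxt n k then x (w ! k) * F w else 0))"

text \<open>The backward generator, adjoint to \<open>gen_bottom\<close>; the latter is inflow minus
  outflow, the word entering \<open>w\<close> over bond \<open>k\<close> being
  \<open>swap_at n w k\<close>.\<close>

definition gen_top :: "(nat \<Rightarrow> real) \<Rightarrow> nat \<Rightarrow> (nat list \<Rightarrow> real) \<Rightarrow> nat list \<Rightarrow> real" where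
  "gen_top x n F u = (\<Sum>k<n.
     if u ! k < u ! nxt n k then x (u ! k) * (F (swap_at n u k) - F u) else 0)"

lemma chain_bottom_sum:
  "chain_bottom x F w = (\<Sum>k<length w - 1.
     (if w ! Suc k < w ! k then x (w ! Suc k) * F (w[k := w ! Suc k, Suc k := w ! k]) else 0)
     - (if w ! k < w ! Suc k then x (w ! k) * F w else 0))"
proof (induction x F w rule: chain_bottom.induct)
  case (1 x F a b l)
  show ?case unfolding chain_bottom.simps 1
    by (simp add: sum.lessThan_Suc_shift del: sum.lessThan_Suc cong: if_cong)
qed auto

lemma chain_top_sum:
  "chain_top x F w = (\<Sum>k<length w - 1.
     (if w ! k < w ! Suc k then x (w ! k) * (F (w[k := w ! Suc k, Suc k := w ! k]) - F w) else 0))"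
proof (induction x F w rule: chain_top.induct)
  case (1 x F a b l)
  show ?case unfolding chain_top.simps 1
    by (simp add: sum.lessThan_Suc_shift del: sum.lessThan_Suc cong: if_cong)
qed auto

lemma gen_bottom_split:
  assumes "length w = n" "2 \<le> n"
  shows "gen_bottom x n F w = chain_bottom x F w
     + (if hd w < last w then x (hd w) * F (last w # butlast (tl w) @ [hd w]) else 0)
     - (if last w < hd w then x (last w) * F w else 0)"
proof -
  obtain m where n: "n = Suc m" "1 \<le> m" using assms by (cases n) auto
  obtain a v b where w: "w = a # v @ [b]"
  proof -
    from assms obtain a w' where "w = a # w'" by (cases w) auto
    moreover from this assms obtain v b where "w' = v @ [b]" by (cases w' rule: rev_cases) auto
    ultimately show ?thesis using that by blast
  qed
  have m: "m = Suc (length v)" using w assms n by simp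
  have "gen_bottom x n F w = (\<Sum>k<m.
     (if w ! nxt n k < w ! k then x (w ! nxt n k) * F (swap_at n w k) else 0)
     - (if w ! k < w ! nxt n k then x (w ! k) * F w else 0))
     + ((if w ! nxt n m < w ! m then x (w ! nxt n m) * F (swap_at n w m) else 0)
     - (if w ! m < w ! nxt n m then x (w ! m) * F w else 0))"
    by (simp add: gen_bottom_def n cong: if_cong)
  also have "(\<Sum>k<m.
     (if w ! nxt n k < w ! k then x (w ! nxt n k) * F (swap_at n w k) else 0)
     - (if w ! k < w ! nxt n k then x (w ! k) * F w else 0)) = chain_bottom x F w"
    unfolding chain_bottom_sum using assms n
    by (intro sum.cong) (auto simp: nxt_def swap_at_def)
  also have "nxt n m = 0" by (simp add: nxt_def n)
  also have "w ! 0 = hd w" using w by simp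
  also have "w ! m = last w" using w m by (simp add: nth_append)
  also have "swap_at n w m = last w # butlast (tl w) @ [hd w]"
    unfolding swap_at_def \<open>nxt n m = 0\<close> using w m by (simp add: nth_append list_update_append)
  finally show ?thesis by simp
qed

lemma gen_top_split:
  assumes "length w = n" "2 \<le> n"
  shows "gen_top x n F w = chain_top x F w
     + (if last w < hd w then x (last w) * (F (last w # butlast (tl w) @ [hd w]) - F w) else 0)"
proof -
  obtain m where n: "n = Suc m" "1 \<le> m" using assms by (cases n) auto
  obtain a v b where w: "w = a # v @ [b]"
  proof -
    from assms obtain a w' where "w = a # w'" by (cases w) auto
    moreover from this assms obtain v b where "w' = v @ [b]" by (cases w' rule: rev_cases) auto
    ultimately show ?thesis using that by blast
  qed
  have m: "m = Suc (length v)" using w assms n by simp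
  have "gen_top x n F w = (\<Sum>k<m.
     if w ! k < w ! nxt n k then x (w ! k) * (F (swap_at n w k) - F w) else 0)
     + (if w ! m < w ! nxt n m then x (w ! m) * (F (swap_at n w m) - F w) else 0)"
    by (simp add: gen_top_def n cong: if_cong)
  also have "(\<Sum>k<m.
     if w ! k < w ! nxt n k then x (w ! k) * (F (swap_at n w k) - F w) else 0) = chain_top x F w"
    unfolding chain_top_sum using assms n
    by (intro sum.cong) (auto simp: nxt_def swap_at_def)
  also have "nxt n m = 0" by (simp add: nxt_def n)
  also have "w ! 0 = hd w" using w by simp
  also have "w ! m = last w" using w m by (simp add: nth_append)
  also have "swap_at n w m = last w # butlast (tl w) @ [hd w]"
    unfolding swap_at_def \<open>nxt n m = 0\<close> using w m by (simp add: nth_append list_update_append)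
  finally show ?thesis by simp
qed

lemma nxt_less: "k < n \<Longrightarrow> nxt n k < n"
  by (simp add: nxt_def)

lemma nxt_neq: "2 \<le> n \<Longrightarrow> k < n \<Longrightarrow> nxt n k \<noteq> k"
  by (cases "Suc k = n") (auto simp: nxt_def)

lemma length_swap_at [simp]: "length (swap_at n w k) = length w"
  by (simp add: swap_at_def)

lemma mset_swap_at: "length w = n \<Longrightarrow> k < n \<Longrightarrow> mset (swap_at n w k) = mset w"
  unfolding swap_at_def by (rule mset_swap) (auto simp: nxt_less)

lemma swap_at_swap_at:
  "2 \<le> n \<Longrightarrow> length w = n \<Longrightarrow> k < n \<Longrightarrow> swap_at n (swap_at n w k) k = w"
  using nxt_neq[of n k] nxt_less[of k n]
  by (simp add: swap_at_def list_update_swap[of k "nxt n k"])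

lemma nth_swap_at:
  "2 \<le> n \<Longrightarrow> length w = n \<Longrightarrow> k < n \<Longrightarrow> swap_at n w k ! k = w ! nxt n k \<and> swap_at n w k ! nxt n k = w ! k"
  using nxt_neq[of n k] nxt_less[of k n]
  by (auto simp: swap_at_def nth_list_update)

lemma nth_rotate1': "length w = n \<Longrightarrow> k < n \<Longrightarrow> rotate1 w ! k = w ! nxt n k"
  using nth_rotate[of k w 1] by (simp add: nxt_def)

lemma swap_at_rotate1:
  assumes "length w = n" "2 \<le> n" "k < n"
  shows "swap_at n (rotate1 w) k = rotate1 (swap_at n w (nxt n k))"
proof (rule nth_equalityI)
  fix i assume "i < length (swap_at n (rotate1 w) k)"
  then have i: "i < n" using assms by simp
  have inj: "nxt n i = nxt n j \<longleftrightarrow> i = j" if "j < n" for j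
  proof
    assume "nxt n i = nxt n j"
    then show "i = j" using that i unfolding nxt_def
      by (cases "Suc i = n"; cases "Suc j = n") auto
  qed simp
  have 1: "nxt n k < n" "nxt n (nxt n k) < n" "nxt n i < n" using assms i by (simp_all add: nxt_less)
  have "swap_at n (rotate1 w) k ! i =
      (if i = nxt n k then w ! nxt n k else if i = k then w ! nxt n (nxt n k) else w ! nxt n i)"
    using assms i 1 by (simp add: swap_at_def nth_list_update nth_rotate1')
  moreover have "rotate1 (swap_at n w (nxt n k)) ! i = swap_at n w (nxt n k) ! nxt n i"
    using assms i by (intro nth_rotate1') auto
  moreover have "swap_at n w (nxt n k) ! nxt n i = (if nxt n i = nxt n (nxt n k) then w ! nxt n k else if nxt n i = nxt n k then w ! nxt n (nxt n k) else w ! nxt n i)"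
    using assms i 1 by (simp add: swap_at_def nth_list_update)
  ultimately show "swap_at n (rotate1 w) k ! i = rotate1 (swap_at n w (nxt n k)) ! i"
    using inj[of k] inj[of "nxt n k"] assms 1 by simp
qed (use assms in simp)

lemma sum_nxt: "(\<Sum>k<n. f (nxt n k)) = (\<Sum>k<n. f k :: real)"
proof (cases n)
  case (Suc m)
  have "(\<Sum>k<n. f (nxt n k)) = (\<Sum>k<m. f (nxt n k)) + f (nxt n m)" by (simp add: Suc)
  also have "(\<Sum>k<m. f (nxt n k)) = (\<Sum>k<m. f (Suc k))"
    by (intro sum.cong) (auto simp: nxt_def Suc)
  also have "nxt n m = 0" by (simp add: nxt_def Suc)
  finally show ?thesis by (simp add: Suc sum.lessThan_Suc_shift del: sum.lessThan_Suc)
qed simp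

lemma gen_bottom_rotate1:
  assumes "length w = n" "2 \<le> n"
  shows "gen_bottom x n F (rotate1 w) = gen_bottom x n (\<lambda>v. F (rotate1 v)) w"
proof -
  define g where "g k = (if w ! nxt n k < w ! k then x (w ! nxt n k) * F (rotate1 (swap_at n w k)) else 0)
     - (if w ! k < w ! nxt n k then x (w ! k) * F (rotate1 w) else 0)" for k
  have "gen_bottom x n F (rotate1 w) = (\<Sum>k<n. g (nxt n k))"
    unfolding gen_bottom_def g_def using assms
    by (intro sum.cong refl) (simp add: nth_rotate1' nxt_less swap_at_rotate1)
  then show ?thesis unfolding sum_nxt by (simp add: gen_bottom_def g_def)
qed

lemma gen_top_rotate1:
  assumes "length w = n" "2 \<le> n"
  shows "gen_top x n F (rotate1 w) = gen_top x n (\<lambda>v. F (rotate1 v)) w"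
proof -
  define g where "g k = (if w ! k < w ! nxt n k then x (w ! k) * (F (rotate1 (swap_at n w k)) - F (rotate1 w)) else 0)" for k
  have "gen_top x n F (rotate1 w) = (\<Sum>k<n. g (nxt n k))"
    unfolding gen_top_def g_def using assms
    by (intro sum.cong refl) (simp add: nth_rotate1' nxt_less swap_at_rotate1)
  then show ?thesis unfolding sum_nxt by (simp add: gen_top_def g_def)
qed

lemma gen_bottom_rotate:
  "length w = n \<Longrightarrow> 2 \<le> n \<Longrightarrow> gen_bottom x n F (rotate m w) = gen_bottom x n (\<lambda>v. F (rotate m v)) w"
  by (induction m arbitrary: F) (simp_all add: gen_bottom_rotate1)

lemma gen_top_rotate:
  "length w = n \<Longrightarrow> 2 \<le> n \<Longrightarrow> gen_top x n F (rotate m w) = gen_top x n (\<lambda>v. F (rotate m v)) w"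
  by (induction m arbitrary: F) (simp_all add: gen_top_rotate1)

section \<open>Cutting the ring at the site serving class \<open>r\<close>\<close>

definition index :: "nat list \<Rightarrow> nat \<Rightarrow> nat" where
  "index l a = length (takeWhile (\<lambda>y. y \<noteq> a) l)"

lemma index_Cons: "index (b # l) a = (if a = b then 0 else Suc (index l a))"
  by (simp add: index_def)

lemma index_append: "index (l @ l') a = (if a \<in> set l then index l a else length l + index l' a)"
  by (auto simp: index_def takeWhile_append)

lemma index_less: "a \<in> set l \<Longrightarrow> index l a < length l"
  by (induction l) (auto simp: index_def)

lemma nth_index: "a \<in> set l \<Longrightarrow> l ! index l a = a"
  by (induction l) (auto simp: index_def)

text \<open>The queue is empty wherever class \<open>r\<close> is served, which is why the ring may be cut at the
  unique position of \<open>r\<close> in the bottom word.\<close>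
definition cut_run :: "nat \<Rightarrow> nat list \<Rightarrow> nat list \<Rightarrow> nat multiset option" where
  "cut_run r w u = (case run r (rotate (index w r) w) (rotate (index w r) u) {#} of
      None \<Rightarrow> None | Some (Q, M) \<Rightarrow> if Q = {#} then Some M else None)"

definition cut_weight :: "(nat \<Rightarrow> real) \<Rightarrow> nat \<Rightarrow> nat list \<Rightarrow> nat list \<Rightarrow> real" where
  "cut_weight x r w u = (case cut_run r w u of None \<Rightarrow> 0 | Some M \<Rightarrow> weight x M)"

lemma cut_weight_run_sum:
  "cut_weight x r w u = run_sum x r (rotate (index w r) w) (rotate (index w r) u) (\<lambda>Q. if Q = {#} then 1 else 0) {#}"
  by (auto simp: cut_weight_def cut_run_def run_sum_def split: option.splits prod.splits)

lemma cut_run_rotate1: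
  assumes "length u = length w" "count_list w r = 1"
  shows "cut_run r (rotate1 w) (rotate1 u) = cut_run r w u"
proof (cases w)
  case (Cons a v)
  show ?thesis
  proof (cases "a = r")
    case True
    have nv: "r \<notin> set v" using assms Cons True by (auto simp: count_list_0_iff)
    then have "index (rotate1 w) r = length v" using Cons True by (simp add: index_append index_Cons)
    moreover have "rotate (length v) (rotate1 w) = w" "rotate (length v) (rotate1 u) = u"
    proof -
      have "rotate (length v) (rotate1 l) = l" if "length l = length w" for l :: "nat list"
      proof -
        have "rotate (length v) (rotate1 l) = rotate (length l) l"
          using that Cons by (simp add: rotate1_rotate_swap)
        then show ?thesis by simp
      qed
      then show "rotate (length v) (rotate1 w) = w" "rotate (length v) (rotate1 u) = u"
        using assms by auto
    qed
    moreover have "index w r = 0" using Cons True by (simp add: index_Cons)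
    ultimately show ?thesis by (simp add: cut_run_def)
  next
    case False
    then have "r \<in> set v" using assms Cons by (metis One_nat_def count_list.simps(2) count_notin zero_neq_one)
    then have "index w r = Suc (index (rotate1 w) r)" using Cons False by (simp add: index_Cons index_append)
    then show ?thesis by (simp add: cut_run_def rotate1_rotate_swap)
  qed
qed (use assms in simp)

lemma count_list_rotate [simp]: "count_list (rotate m l) a = count_list l a"
proof (induction m)
  case (Suc m)
  then show ?case by (cases "rotate m l") auto
qed simp

lemma cut_run_rotate:
  assumes "length u = length w" "count_list w r = 1"
  shows "cut_run r (rotate m w) (rotate m u) = cut_run r w u"
proof (induction m)
  case (Suc m)
  have "count_list (rotate m w) r = 1" using assms by simp
  then have "cut_run r (rotate1 (rotate m w)) (rotate1 (rotate m u)) = cut_run r (rotate m w) (rotate m u)"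
    using assms by (intro cut_run_rotate1) auto
  then show ?case using Suc by simp
qed simp

lemma front_eq_top: "queue_ok r Q \<Longrightarrow> front r Q = r \<longleftrightarrow> Q = {#}"
proof
  assume ok: "queue_ok r Q" and "front r Q = r"
  show "Q = {#}"
  proof (rule ccontr)
    assume "Q \<noteq> {#}"
    then obtain q where q: "q \<in># Q" by blast
    then have "front r Q \<le> q" by (simp add: front_def)
    then show False using ok q \<open>front r Q = r\<close> by (auto simp: queue_ok_def)
  qed
qed simp

text \<open>\<open>front\<close> equals \<open>r\<close> only for an empty queue, so when
  \<open>r\<close> is served nobody waits and the arrival is a top letter \<open>r\<close>, which is
  not stored.\<close>

lemma site_top:
  assumes "queue_ok r Q" "1 \<le> u" "u \<le> r"
  shows "site x r r u f Q = (if u = r \<and> Q = {#} then f {#} else 0)"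
proof -
  have "front r (arrive r u Q) = r \<longleftrightarrow> u = r \<and> Q = {#}"
    using front_arrive[of u r Q] front_eq_top[OF assms(1)] front_le[of r Q] assms by (auto simp: min_def)
  then show ?thesis by (auto simp: site_def Let_def arrive_def)
qed

lemma site_empty:
  assumes "1 \<le> u" "u \<le> r"
  shows "site x r w u f {#} = (if w = Suc r then inverse (x u) * f (arrive r u {#}) else if w = u then f {#} else 0)"
  using assms front_arrive[of u r "{#}"] arrive_diff_self[of r "{#}" u] by (simp add: site_def Let_def)

text \<open>The leftmost site is processed last. Serving \<open>r\<close>, it merely tests that
  \<open>r\<close> stands above it and that the other sites leave an empty queue.\<close>

lemma run_sum_cut:
  assumes "length v = length us" "set us \<subseteq> {1..r}" "1 \<le> u" "u \<le> r" "queue_ok r Q"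
  shows "run_sum x r (r # v) (u # us) f Q = (if u = r then run_sum x r v us (\<lambda>Q. if Q = {#} then f {#} else 0) Q else 0)"
proof -
  have "run_sum x r (r # v) (u # us) f Q = run_sum x r v us (\<lambda>Q. if u = r then if Q = {#} then f {#} else 0 else 0) Q"
    unfolding run_sum_Cons using assms
    by (intro run_sum_ok_cong) (auto simp: site_top)
  then show ?thesis by simp
qed

lemma run_sum_snoc:
  assumes "length v = length us"
  shows "run_sum x r (v @ [w]) (us @ [u]) f Q = site x r w u (run_sum x r v us f) Q"
proof -
  have "run_sum x r (v @ [w]) (us @ [u]) f Q = run_sum x r [w] [u] (run_sum x r v us f) Q"
    using assms by (simp add: run_sum_append)
  then show ?thesis by simp
qed

lemma rotate_snoc_to_front: "length v = m \<Longrightarrow> rotate m (v @ [a]) = a # v"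
  using rotate_append[of v "[a]"] by simp

abbreviation at_empty :: "nat multiset \<Rightarrow> real" where
  "at_empty Q \<equiv> if Q = {#} then 1 else 0"

lemma cut_weight_hd: "cut_weight x r (r # v) u = run_sum x r (r # v) u at_empty {#}"
  by (simp add: cut_weight_run_sum index_Cons)

text \<open>With \<open>r\<close> at the head, \<open>chain_telescope\<close> applies; the hat at
  the head vanishes because \<open>r\<close> is not a hole. It remains to match the hat at the last
  site with the closing bond. The swaps over the first and the closing bottom bond move
  \<open>r\<close> and with it the cut, so their weights are computed anew.\<close>

lemma intertwining_cut:
  assumes len: "length us = length ws" "ws \<noteq> []" and n: "n = Suc (length ws)"
    and ws: "set ws \<subseteq> {1..Suc r}" "r \<notin> set ws" and us: "set us \<subseteq> {1..r}" and u: "1 \<le> u" "u \<le> r"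
    and x: "\<forall>i\<in>{1..r}. x i \<noteq> (0::real)"
  shows "gen_bottom x n (\<lambda>v. cut_weight x r v (u # us)) (r # ws)
       = gen_top x n (\<lambda>v. cut_weight x r (r # ws) v) (u # us)"
proof -
  have n2: "2 \<le> n" using len n by (cases ws) auto
  let ?S = "\<lambda>v u. run_sum x r v u at_empty {#}"
  let ?F = "\<lambda>v. cut_weight x r v (u # us)"
  have bottom: "chain_bottom x ?F (r # ws) = chain_bottom x (\<lambda>v. ?S v (u # us)) (r # ws)"
  proof -
    obtain b ws' where w: "ws = b # ws'" using len by (cases ws) auto
    obtain u1 us' where u': "us = u1 # us'" using len w by (cases us) auto
    \<comment> \<open>Before or after the site of \<open>r\<close> the queue is empty, so serving
      \<open>b\<close> first or last gives the same condition \<open>b = u\<close>.\<close>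
    have "?F (b # r # ws') = ?S (b # r # ws') (u # us)" if "b < r"
    proof -
      have "index (b # r # ws') r = 1" using that by (simp add: index_Cons)
      then have "?F (b # r # ws') = ?S ((r # ws') @ [b]) ((u1 # us') @ [u])"
        by (simp add: cut_weight_run_sum u')
      also have "\<dots> = site x r b u (run_sum x r (r # ws') (u1 # us') at_empty) {#}"
        using len w u' by (intro run_sum_snoc) simp
      also have "\<dots> = (if b = u \<and> u1 = r then ?S ws' us' else 0)"
        using u us u' len w that by (auto simp: site_empty run_sum_cut simp del: run_sum_Cons)
      finally have 1: "?F (b # r # ws') = \<dots>" .
      have "?S (b # r # ws') (u # us) = run_sum x r (r # ws') (u1 # us') (site x r b u at_empty) {#}"
        by (simp add: u')
      also have "\<dots> = (if u1 = r then run_sum x r ws' us' (\<lambda>Q. if Q = {#} then site x r b u at_empty {#} else 0) {#} else 0)"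
        using u us u' len w that by (intro run_sum_cut) auto
      moreover have "(\<lambda>Q. if Q = {#} then site x r b u at_empty {#} else 0) = (\<lambda>Q. if b = u then at_empty Q else 0)"
        using u that by (auto simp: site_empty)
      ultimately have "?S (b # r # ws') (u # us) = (if u1 = r then if b = u then ?S ws' us' else run_sum x r ws' us' (\<lambda>Q. 0) {#} else 0)"
        by (simp only: run_sum_if)
      then show ?thesis unfolding 1 by simp
    qed
    then show ?thesis by (auto simp: w cut_weight_hd)
  qed
  have top: "chain_top x (\<lambda>v. cut_weight x r (r # ws) v) (u # us) = chain_top x (\<lambda>v. ?S (r # ws) v) (u # us)"
    by (simp add: cut_weight_hd)
  have "site_hat r r u at_empty = (\<lambda>_. 0)"
    by (rule ext) (simp add: site_hat_def)
  then have tele: "chain_bottom x (\<lambda>v. ?S v (u # us)) (r # ws) - chain_top x (\<lambda>v. ?S (r # ws) v) (u # us)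
      = site_hat r (last (r # ws)) (last (u # us)) (run_sum x r (butlast (r # ws)) (butlast (u # us)) at_empty) {#}"
    using chain_telescope[of "r # ws" "u # us" r x "{#}" at_empty] assms by (auto simp: subset_iff)
  obtain mid l where w: "ws = mid @ [l]" using len by (cases ws rule: rev_cases) auto
  obtain umid ul where u': "us = umid @ [ul]" using len w by (cases us rule: rev_cases) auto
  have lens: "length mid = length umid" using len w u' by simp
  have ul: "1 \<le> ul" "ul \<le> r" "set umid \<subseteq> {1..r}" using us u' by auto
  have l: "l \<noteq> r" "l \<le> Suc r" "r \<notin> set mid" using ws w by auto
  let ?G = "run_sum x r mid umid at_empty"
  have cut: "run_sum x r (r # mid) (u # umid) at_empty Q = (if u = r then ?G Q else 0)" if "queue_ok r Q" for Q
    using run_sum_cut[of mid umid r u Q x at_empty] that lens ul u by (simp cong: if_cong)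
  have ok: "queue_ok r (arrive r ul {#})" using ul by (simp add: queue_ok_arrive)
  have F0: "?F (r # ws) = (if l = Suc r then inverse (x ul) * (if u = r then ?G (arrive r ul {#}) else 0)
      else if l = ul \<and> u = r then ?G {#} else 0)"
  proof -
    have "?F (r # ws) = run_sum x r ((r # mid) @ [l]) ((u # umid) @ [ul]) at_empty {#}"
      by (simp only: cut_weight_hd w u' append_Cons)
    also have "\<dots> = site x r l ul (run_sum x r (r # mid) (u # umid) at_empty) {#}"
      using lens by (intro run_sum_snoc) simp
    finally show ?thesis
      unfolding site_empty[OF ul(1,2)] cut[OF ok] cut[OF queue_ok_empty] by simp
  qed
  have hat: "site_hat r (last (r # ws)) (last (u # us)) (run_sum x r (butlast (r # ws)) (butlast (u # us)) at_empty) {#}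
     = (if l = Suc r \<and> u = r then - ?G (arrive r ul {#}) else 0)"
    using cut[OF ok] by (cases "u = r") (simp_all add: w u' site_hat_def butlast_append del: run_sum_Cons)
  \<comment> \<open>Now \<open>r\<close> stands below \<open>ul\<close>, and the hole replacing it
    is processed just before the cut. The queue must be empty there, which forces
    \<open>u = r\<close> and the weight \<open>1 / x_r\<close>.\<close>
  have F1: "?F (Suc r # mid @ [r]) = (if ul = r \<and> u = r then inverse (x r) * ?G {#} else 0)"
  proof -
    have "index (Suc r # mid @ [r]) r = Suc (length mid)" using l by (simp add: index_Cons index_append)
    then have "?F (Suc r # mid @ [r]) = ?S (r # Suc r # mid) (ul # u # umid)"
      using rotate_snoc_to_front[of "Suc r # mid" "Suc (length mid)" r]
        rotate_snoc_to_front[of "u # umid" "Suc (length mid)" ul] lens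
      by (simp add: cut_weight_run_sum u' del: run_sum_Cons)
    also have "\<dots> = (if ul = r then ?S (Suc r # mid) (u # umid) else 0)"
      using run_sum_cut[of "Suc r # mid" "u # umid" r ul "{#}" x at_empty] lens ul u by (simp cong: if_cong)
    finally have 1: "?F (Suc r # mid @ [r]) = (if ul = r then ?S (Suc r # mid) (u # umid) else 0)" .
    have "?S (Suc r # mid) (u # umid) = run_sum x r mid umid (\<lambda>Q. if u = r then inverse (x r) * at_empty Q else 0) {#}"
      unfolding run_sum_Cons
    proof (rule run_sum_ok_cong)
      fix Q assume "queue_ok r Q"
      then show "site x r (Suc r) u at_empty Q = (if u = r then inverse (x r) * at_empty Q else 0)"
        using u by (auto simp: site_def Let_def arrive_def)
    qed (use lens ul in auto)
    also have "\<dots> = (if u = r then inverse (x r) * ?G {#} else 0)"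
      by (simp add: run_sum_if run_sum_cmult)
    finally have "?S (Suc r # mid) (u # umid) = (if u = r then inverse (x r) * ?G {#} else 0)" by simp
    then show ?thesis unfolding 1 by (cases "u = r") simp_all
  qed
  have F2: "cut_weight x r (r # ws) (ul # umid @ [u]) = 0" if "ul < r"
    unfolding cut_weight_hd using run_sum_cut[of ws "umid @ [u]" r ul "{#}" x at_empty] that lens ul u w
    by (simp del: run_sum_Cons)
  have gb: "gen_bottom x n ?F (r # ws) = chain_bottom x ?F (r # ws)
     + (if r < l then x r * ?F (l # mid @ [r]) else 0) - (if l < r then x l * ?F (r # ws) else 0)"
    using gen_bottom_split[of "r # ws" n x ?F] n n2 w by simp
  have gt: "gen_top x n (\<lambda>v. cut_weight x r (r # ws) v) (u # us) = chain_top x (\<lambda>v. cut_weight x r (r # ws) v) (u # us)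
     + (if ul < u then x ul * (cut_weight x r (r # ws) (ul # umid @ [u]) - ?F (r # ws)) else 0)"
    using gen_top_split[of "u # us" n x "\<lambda>v. cut_weight x r (r # ws) v"] n n2 len u' by simp
  have xul: "x ul \<noteq> 0" "x r \<noteq> 0" using x ul by auto
  have "gen_bottom x n ?F (r # ws) - gen_top x n (\<lambda>v. cut_weight x r (r # ws) v) (u # us)
    = (if l = Suc r \<and> u = r then - ?G (arrive r ul {#}) else 0)
     + (if r < l then x r * ?F (l # mid @ [r]) else 0) - (if l < r then x l * ?F (r # ws) else 0)
     - (if ul < u then x ul * (cut_weight x r (r # ws) (ul # umid @ [u]) - ?F (r # ws)) else 0)"
    unfolding gb gt bottom top using tele unfolding hat by linarith
  \<comment> \<open>For \<open>l = Suc r\<close> and \<open>u = r\<close> the hat cancels the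
    closing bottom bond if \<open>ul = r\<close> and the closing top bond if \<open>ul < r\<close>.
    For \<open>l < r\<close> the two closing bonds cancel each other.\<close>
  also have "\<dots> = 0"
  proof (cases "l = Suc r")
    case True
    then show ?thesis using F0 F1 F2 xul u ul by (auto simp: arrive_def)
  next
    case False
    then have "l < r" using l by simp
    then show ?thesis using F0 F2 xul u ul False by auto
  qed
  finally show ?thesis by simp
qed

lemma intertwining:
  assumes len: "length w = n" "length u = n" and n: "2 \<le> n"
    and w: "set w \<subseteq> {1..Suc r}" "count_list w r = 1" and u: "set u \<subseteq> {1..r}"
    and x: "\<forall>i\<in>{1..r}. x i \<noteq> (0::real)"
  shows "gen_bottom x n (\<lambda>v. cut_weight x r v u) w = gen_top x n (\<lambda>v. cut_weight x r w v) u"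
proof -
  define p where "p = index w r"
  define w' where "w' = rotate p w"
  define u' where "u' = rotate p u"
  have "r \<in> set w" using w(2) by (metis count_notin zero_neq_one)
  then have p: "p < n" using index_less len p_def by metis
  have rot_back: "rotate (n - p) w' = w" "rotate (n - p) u' = u"
    using p len by (simp_all add: w'_def u'_def rotate_rotate)
  have c: "count_list w' r = 1"
    using w(2) unfolding w'_def by simp
  have eq: "cut_weight x r (rotate m v) (rotate m v') = cut_weight x r v v'"
    if "length v = length v'" "count_list v r = 1" for v v' m
    using that by (simp add: cut_weight_def cut_run_rotate)
  have lens: "length w' = n" "length u' = n" using len by (simp_all add: w'_def u'_def)
  have "gen_bottom x n (\<lambda>v. cut_weight x r v u) w = gen_bottom x n (\<lambda>v. cut_weight x r (rotate (n - p) v) (rotate (n - p) u')) w'"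
    using gen_bottom_rotate[of w' n x "\<lambda>v. cut_weight x r v u" "n - p"] lens n rot_back by simp
  also have "\<dots> = gen_bottom x n (\<lambda>v. cut_weight x r v u') w'"
  proof -
    have "count_list (swap_at n w' k) r = 1" if "k < n" for k
      using c mset_swap_at[OF lens(1) that] by (simp flip: count_mset)
    then show ?thesis unfolding gen_bottom_def
      by (intro sum.cong refl) (simp add: eq lens c)
  qed
  also have "\<dots> = gen_top x n (\<lambda>v. cut_weight x r w' v) u'"
  proof -
    obtain a ws where w'a: "w' = a # ws" using lens n by (cases w') auto
    obtain b us where u'b: "u' = b # us" using lens n by (cases u') auto
    have "w \<noteq> []" using len n by auto
    then have "hd w' = r"
      using p len nth_index[OF \<open>r \<in> set w\<close>] by (simp add: w'_def p_def hd_rotate_conv_nth)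
    then have "a = r" using w'a by simp
    moreover have "set w' \<subseteq> {1..Suc r}" "set u' \<subseteq> {1..r}" using w u by (simp_all add: w'_def u'_def)
    moreover have "r \<notin> set ws" using c \<open>a = r\<close> w'a by (auto simp: count_list_0_iff)
    moreover have "ws \<noteq> []" "length us = length ws" "n = Suc (length ws)" using w'a u'b lens n by auto
    ultimately show ?thesis unfolding w'a u'b
      using intertwining_cut[of us ws n r b x] w'a u'b x by auto
  qed
  also have "\<dots> = gen_top x n (\<lambda>v. cut_weight x r (rotate (n - p) w') (rotate (n - p) v)) u'"
    unfolding gen_top_def by (intro sum.cong refl) (simp add: eq lens c)
  also have "\<dots> = gen_top x n (\<lambda>v. cut_weight x r w v) u"
    using gen_top_rotate[of u' n x "\<lambda>v. cut_weight x r w v" "n - p"] lens n rot_back by simp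
  finally show ?thesis .
qed

lemma run_queue_ok:
  "run r ws us Q = Some (Q', M) \<Longrightarrow> queue_ok r Q \<Longrightarrow> set us \<subseteq> {1..} \<Longrightarrow> queue_ok r Q'"
  by (induction r ws us Q arbitrary: Q' M rule: run.induct)
    (auto simp: Let_def split: option.splits if_splits intro!: queue_ok_arrive queue_ok_diff)

section \<open>The steady state as a sum of monomials\<close>

text \<open>Level \<open>n - 1\<close> leaves a single hole, the letter \<open>n\<close>, so the
  states occur among these words without recoding.\<close>

definition words :: "nat \<Rightarrow> nat \<Rightarrow> nat list set" where
  "words n r = {w. length w = n \<and> set w \<subseteq> {1..Suc r} \<and> (\<forall>i\<in>{1..r}. count_list w i = 1)}"

lemma finite_words: "finite (words n r)"
proof (rule finite_subset)
  show "words n r \<subseteq> {w. set w \<subseteq> {1..Suc r} \<and> length w = n}" by (auto simp: words_def)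
qed (simp add: finite_lists_length_eq)

lemma words_mset: "w \<in> words n r \<Longrightarrow> mset v = mset w \<Longrightarrow> v \<in> words n r"
proof -
  assume w: "w \<in> words n r" and m: "mset v = mset w"
  have "length v = length w" "set v = set w" using m by (metis size_mset, metis set_mset_mset)
  moreover have "count_list v i = count_list w i" for i using m by (simp flip: count_mset)
  ultimately show ?thesis using w by (simp add: words_def)
qed

lemma words_swap_at: "w \<in> words n r \<Longrightarrow> k < n \<Longrightarrow> swap_at n w k \<in> words n r"
  using words_mset[of w n r "swap_at n w k"] mset_swap_at[of w n k] by (simp add: words_def)

lemma St_subset_words: "1 \<le> n \<Longrightarrow> St n \<subseteq> words n (n - 1)"
proof
  fix w assume "1 \<le> n" and w: "w \<in> St n"
  have "count_list w i = 1" if "i \<in> set w" for i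
    using w that by (simp add: St_def distinct_count_atmost_1 flip: count_mset)
  then show "w \<in> words n (n - 1)" using w \<open>1 \<le> n\<close> by (auto simp: St_def words_def)
qed

text \<open>A hole with front class \<open>m\<close> carries \<open>x_1 \<cdots> x_r / x_m\<close>.\<close>
definition hole_exponent :: "nat \<Rightarrow> nat multiset \<Rightarrow> nat \<Rightarrow> nat" where
  "hole_exponent r M k = (if 1 \<le> k \<and> k \<le> r then size M - count M k else 0)"

text \<open>A multiset, so that evaluation becomes a sum with positive integer coefficients. Level 0
  has only the word of holes and the empty monomial.\<close>

primrec monomials :: "nat \<Rightarrow> nat \<Rightarrow> nat list \<Rightarrow> (nat \<Rightarrow> nat) multiset" where
  "monomials n 0 w = {#\<lambda>_. 0#}"
| "monomials n (Suc r) w = (\<Sum>u\<in>words n r. case cut_run (Suc r) w u of None \<Rightarrow> {#}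
      | Some M \<Rightarrow> image_mset (\<lambda>\<alpha> k. \<alpha> k + hole_exponent (Suc r) M k) (monomials n r u))"

definition steady :: "nat \<Rightarrow> (nat \<Rightarrow> real) \<Rightarrow> nat \<Rightarrow> nat list \<Rightarrow> real" where
  "steady n x r w = (\<Sum>\<alpha>\<in>#monomials n r w. \<Prod>k\<in>{1..n}. x k ^ \<alpha> k)"

lemma sum_mset_sum: "finite A \<Longrightarrow> (\<Sum>\<alpha>\<in>#(\<Sum>u\<in>A. P u). g \<alpha>) = (\<Sum>u\<in>A. \<Sum>\<alpha>\<in>#P u. (g \<alpha> :: real))"
  by (induction A rule: finite_induct) auto

lemma run_size:
  "run r ws us Q = Some (Q', M) \<Longrightarrow> size M = count_list ws (Suc r)"
  by (induction r ws us Q arbitrary: Q' M rule: run.induct)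
    (auto simp: Let_def split: option.splits if_splits)

lemma run_holes:
  "run r ws us Q = Some (Q', M) \<Longrightarrow> queue_ok r Q \<Longrightarrow> set us \<subseteq> {1..} \<Longrightarrow> 1 \<le> r \<Longrightarrow> set_mset M \<subseteq> {1..r}"
proof (induction r ws us Q arbitrary: Q' M rule: run.induct)
  case (2 r w ws u us Q)
  then obtain Q1 M1 where 1: "run r ws us Q = Some (Q1, M1)" by (auto split: option.splits)
  have "queue_ok r (arrive r u Q1)"
    using run_queue_ok[OF 1] 2 by (auto intro!: queue_ok_arrive)
  then have "front r (arrive r u Q1) \<in> {1..r}" using front_ge_1 front_le 2 by simp
  moreover have "set_mset M1 \<subseteq> {1..r}" using 2 1 by auto
  ultimately show ?case using 2 1 by (auto simp: Let_def split: if_splits)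
qed auto

lemma cut_run_size: "cut_run r w u = Some M \<Longrightarrow> size M = count_list w (Suc r)"
  by (auto simp: cut_run_def dest!: run_size split: option.splits if_splits)

lemma cut_run_holes: "cut_run r w u = Some M \<Longrightarrow> set u \<subseteq> {1..} \<Longrightarrow> 1 \<le> r \<Longrightarrow> set_mset M \<subseteq> {1..r}"
  by (auto simp: cut_run_def subset_iff dest!: run_holes split: option.splits if_splits)

lemma prod_hole_exponent:
  assumes "set_mset M \<subseteq> {1..r}" "r \<le> n" "\<forall>i\<in>{1..r}. x i \<noteq> (0::real)"
  shows "(\<Prod>k\<in>{1..n}. x k ^ hole_exponent r M k) = (\<Prod>i\<in>{1..r}. x i) ^ size M * weight x M"
proof -
  have "(\<Prod>k\<in>{1..n}. x k ^ hole_exponent r M k) = (\<Prod>k\<in>{1..r}. x k ^ (size M - count M k))"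
    using assms(2) by (intro prod.mono_neutral_cong_right) (auto simp: hole_exponent_def)
  also have "\<dots> = (\<Prod>k\<in>{1..r}. x k ^ size M * inverse (x k) ^ count M k)"
  proof (rule prod.cong)
    fix k assume "k \<in> {1..r}"
    then have "x k \<noteq> 0" using assms by auto
    then show "x k ^ (size M - count M k) = x k ^ size M * inverse (x k) ^ count M k"
      using count_le_size[of M k] by (simp add: power_diff field_simps power_inverse)
  qed simp
  also have "\<dots> = (\<Prod>k\<in>{1..r}. x k) ^ size M * (\<Prod>k\<in>{1..r}. inverse (x k) ^ count M k)"
    by (simp add: prod.distrib prod_power_distrib)
  also have "(\<Prod>k\<in>{1..r}. inverse (x k) ^ count M k) = weight x M"
    unfolding weight_def using assms(1)
    unfolding image_prod_mset_multiplicity by (intro prod.mono_neutral_right) (auto simp: not_in_iff)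
  finally show ?thesis .
qed

lemma steady_0: "steady n x 0 w = 1"
  by (simp add: steady_def)

lemma steady_Suc_raw:
  "steady n x (Suc r) w = (\<Sum>u\<in>words n r. case cut_run (Suc r) w u of None \<Rightarrow> 0
     | Some M \<Rightarrow> (\<Prod>k\<in>{1..n}. x k ^ hole_exponent (Suc r) M k) * steady n x r u)"
proof -
  have "(\<Sum>\<alpha>\<in>#image_mset (\<lambda>\<alpha> k. \<alpha> k + hole_exponent (Suc r) M k) P. \<Prod>k\<in>{1..n}. x k ^ \<alpha> k)
      = (\<Prod>k\<in>{1..n}. x k ^ hole_exponent (Suc r) M k) * (\<Sum>\<alpha>\<in>#P. \<Prod>k\<in>{1..n}. x k ^ \<alpha> k)" for M P
    by (induction P) (simp_all add: power_add prod.distrib algebra_simps)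
  then show ?thesis
    unfolding steady_def
    by (auto simp: sum_mset_sum[OF finite_words] intro!: sum.cong split: option.splits)
qed

text \<open>The factor clearing denominators depends only on the number of holes of
  \<open>w\<close>. Swaps preserve it, so it drops out of the balance equation.\<close>

lemma steady_Suc:
  assumes "Suc r \<le> n" "\<forall>i\<in>{1..Suc r}. x i \<noteq> (0::real)"
  shows "steady n x (Suc r) w = (\<Prod>i\<in>{1..Suc r}. x i) ^ count_list w (Suc (Suc r)) *
     (\<Sum>u\<in>words n r. cut_weight x (Suc r) w u * steady n x r u)"
proof -
  have "(case cut_run (Suc r) w u of None \<Rightarrow> 0
     | Some M \<Rightarrow> (\<Prod>k\<in>{1..n}. x k ^ hole_exponent (Suc r) M k) * steady n x r u)
     = (\<Prod>i\<in>{1..Suc r}. x i) ^ count_list w (Suc (Suc r)) * (cut_weight x (Suc r) w u * steady n x r u)"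
    if "u \<in> words n r" for u
  proof (cases "cut_run (Suc r) w u")
    case None
    then show ?thesis by (simp add: cut_weight_def)
  next
    case (Some M)
    then have "set_mset M \<subseteq> {1..Suc r}" using cut_run_holes[OF Some] that by (simp add: words_def subset_iff)
    then show ?thesis using prod_hole_exponent[of M "Suc r" n x] assms cut_run_size[OF Some] Some
      by (simp add: cut_weight_def)
  qed
  then show ?thesis unfolding steady_Suc_raw sum_distrib_left by (intro sum.cong) auto
qed

section \<open>Balance equations by induction over the levels\<close>

lemma gen_duality:
  assumes U: "finite U" "\<And>u k. u \<in> U \<Longrightarrow> k < n \<Longrightarrow> swap_at n u k \<in> U" "\<And>u. u \<in> U \<Longrightarrow> length u = n" and n: "2 \<le> n"
  shows "(\<Sum>u\<in>U. S u * gen_top x n F u) = (\<Sum>u\<in>U. F u * gen_bottom x n S u)"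
proof -
  \<comment> \<open>Summation by parts: for a fixed bond the swap is an involution that exchanges
    ascents and descents.\<close>
  have "(\<Sum>u\<in>U. if u ! k < u ! nxt n k then x (u ! k) * S u * F (swap_at n u k) else 0)
      = (\<Sum>u\<in>U. if u ! nxt n k < u ! k then x (u ! nxt n k) * S (swap_at n u k) * F u else 0)" if "k < n" for k
    by (rule sum.reindex_bij_witness[where i = "\<lambda>u. swap_at n u k" and j = "\<lambda>u. swap_at n u k"])
      (use U n that in \<open>auto simp: swap_at_swap_at nth_swap_at\<close>)
  then have "(\<Sum>k<n. \<Sum>u\<in>U. if u ! k < u ! nxt n k then x (u ! k) * S u * F (swap_at n u k) else 0)
      = (\<Sum>k<n. \<Sum>u\<in>U. if u ! nxt n k < u ! k then x (u ! nxt n k) * S (swap_at n u k) * F u else 0)"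
    by simp
  then have *: "(\<Sum>u\<in>U. \<Sum>k<n. if u ! k < u ! nxt n k then x (u ! k) * S u * F (swap_at n u k) else 0)
      = (\<Sum>u\<in>U. \<Sum>k<n. if u ! nxt n k < u ! k then x (u ! nxt n k) * S (swap_at n u k) * F u else 0)"
    by (simp only: sum.swap[of _ U])
  have "(\<Sum>u\<in>U. S u * gen_top x n F u) = (\<Sum>u\<in>U. \<Sum>k<n. if u ! k < u ! nxt n k then x (u ! k) * S u * F (swap_at n u k) else 0)
     - (\<Sum>u\<in>U. \<Sum>k<n. if u ! k < u ! nxt n k then x (u ! k) * S u * F u else 0)"
    unfolding gen_top_def sum_distrib_left sum_subtractf[symmetric]
    by (intro sum.cong) (auto simp: algebra_simps)
  also have "\<dots> = (\<Sum>u\<in>U. F u * gen_bottom x n S u)"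
    unfolding * gen_bottom_def sum_distrib_left sum_subtractf[symmetric]
    by (intro sum.cong) (auto simp: algebra_simps)
  finally show ?thesis .
qed

lemma gen_bottom_sum: "gen_bottom x n (\<lambda>v. \<Sum>u\<in>U. f v u * g u) w = (\<Sum>u\<in>U. g u * gen_bottom x n (\<lambda>v. f v u) w)"
proof -
  have "(\<Sum>u\<in>U. g u * gen_bottom x n (\<lambda>v. f v u) w) = (\<Sum>k<n. \<Sum>u\<in>U. g u *
     ((if w ! nxt n k < w ! k then x (w ! nxt n k) * f (swap_at n w k) u else 0)
     - (if w ! k < w ! nxt n k then x (w ! k) * f w u else 0)))"
    unfolding gen_bottom_def sum_distrib_left by (rule sum.swap)
  also have "\<dots> = gen_bottom x n (\<lambda>v. \<Sum>u\<in>U. f v u * g u) w"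
    unfolding gen_bottom_def
  proof (rule sum.cong)
    fix k
    show "(\<Sum>u\<in>U. g u * ((if w ! nxt n k < w ! k then x (w ! nxt n k) * f (swap_at n w k) u else 0)
      - (if w ! k < w ! nxt n k then x (w ! k) * f w u else 0))) =
      (if w ! nxt n k < w ! k then x (w ! nxt n k) * (\<Sum>u\<in>U. f (swap_at n w k) u * g u) else 0)
     - (if w ! k < w ! nxt n k then x (w ! k) * (\<Sum>u\<in>U. f w u * g u) else 0)"
      by (simp add: sum_distrib_left sum_negf mult.left_commute mult.commute)
  qed simp
  finally show ?thesis ..
qed

text \<open>Intertwining moves the generator from the bottom word to the top word, duality moves it
  on to the vector of the previous level, and there it gives 0 by induction. At level 0 all letters
  agree and nothing moves.\<close>

lemma steady_balance:
  assumes n: "2 \<le> n" and x: "\<forall>i\<in>{1..n}. x i \<noteq> (0::real)"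
  shows "r < n \<Longrightarrow> w \<in> words n r \<Longrightarrow> gen_bottom x n (steady n x r) w = 0"
proof (induction r arbitrary: w)
  case 0
  have "w ! k = 1" if "k < n" for k
  proof -
    have "w ! k \<in> {1..Suc 0}" using 0 that nth_mem[of k w] unfolding words_def by blast
    then show ?thesis by simp
  qed
  then show ?case by (simp add: gen_bottom_def nxt_less)
next
  case (Suc r)
  let ?U = "words n r"
  let ?T = "cut_weight x (Suc r)"
  define K where "K = (\<Prod>i\<in>{1..Suc r}. x i) ^ count_list w (Suc (Suc r))"
  have xr: "\<forall>i\<in>{1..Suc r}. x i \<noteq> 0" using x Suc.prems by auto
  have len: "length w = n" using Suc.prems by (simp add: words_def)
  have st: "steady n x (Suc r) v = K * (\<Sum>u\<in>?U. ?T v u * steady n x r u)" if "mset v = mset w" for v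
  proof -
    have "count_list v (Suc (Suc r)) = count_list w (Suc (Suc r))" using that by (simp flip: count_mset)
    then show ?thesis using steady_Suc[of r n x v] Suc.prems xr unfolding K_def by simp
  qed
  have "gen_bottom x n (steady n x (Suc r)) w = K * gen_bottom x n (\<lambda>v. \<Sum>u\<in>?U. ?T v u * steady n x r u) w"
    unfolding gen_bottom_def sum_distrib_left[where r = K]
  proof (rule sum.cong)
    fix k assume "k \<in> {..<n}"
    then have "mset (swap_at n w k) = mset w" using mset_swap_at[OF len] by simp
    then show "(if w ! nxt n k < w ! k then x (w ! nxt n k) * steady n x (Suc r) (swap_at n w k) else 0)
         - (if w ! k < w ! nxt n k then x (w ! k) * steady n x (Suc r) w else 0) =
         K * ((if w ! nxt n k < w ! k then x (w ! nxt n k) * (\<Sum>u\<in>?U. ?T (swap_at n w k) u * steady n x r u) else 0)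
         - (if w ! k < w ! nxt n k then x (w ! k) * (\<Sum>u\<in>?U. ?T w u * steady n x r u) else 0))"
      by (auto simp: st algebra_simps)
  qed simp
  also have "gen_bottom x n (\<lambda>v. \<Sum>u\<in>?U. ?T v u * steady n x r u) w
      = (\<Sum>u\<in>?U. steady n x r u * gen_bottom x n (\<lambda>v. ?T v u) w)"
    by (rule gen_bottom_sum)
  also have "\<dots> = (\<Sum>u\<in>?U. steady n x r u * gen_top x n (\<lambda>v. ?T w v) u)"
  proof (rule sum.cong)
    fix u assume u: "u \<in> ?U"
    show "steady n x r u * gen_bottom x n (\<lambda>v. ?T v u) w = steady n x r u * gen_top x n (\<lambda>v. ?T w v) u"
      using intertwining[of w n u "Suc r" x] u n xr Suc.prems by (simp add: words_def)
  qed simp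
  also have "\<dots> = (\<Sum>u\<in>?U. ?T w u * gen_bottom x n (steady n x r) u)"
    using n by (intro gen_duality finite_words words_swap_at) (auto simp: words_def)
  also have "\<dots> = 0" using Suc by simp
  finally show ?case by simp
qed

section \<open>Uniqueness of the stationary vector and identification of \<open>psi\<close>\<close>

lemma St_swap_at: "w \<in> St n \<Longrightarrow> k < n \<Longrightarrow> swap_at n w k \<in> St n"
proof -
  assume w: "w \<in> St n" and k: "k < n"
  have m: "mset (swap_at n w k) = mset w" using w k by (simp add: mset_swap_at St_def)
  then have "set (swap_at n w k) = set w" "distinct (swap_at n w k) = distinct w"
    by (metis set_mset_mset, metis mset_eq_imp_distinct_iff)
  then show ?thesis using w by (simp add: St_def)
qed

lemma finite_St: "finite (St n)"
proof (rule finite_subset)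
  show "St n \<subseteq> {w. set w \<subseteq> {1..n} \<and> length w = n}" by (auto simp: St_def)
qed (simp add: finite_lists_length_eq)

text \<open>Over bond \<open>k\<close> the only possible predecessor of \<open>w\<close> is
  \<open>swap_at n w k\<close>, so the sum over \<open>v\<close> collapses.\<close>

lemma stationary_balance:
  assumes "2 \<le> n" "stationary n x \<pi>" "w \<in> St n"
  shows "gen_bottom x n \<pi> w = 0"
proof -
  have len: "length w = n" using assms by (simp add: St_def)
  have "(\<Sum>v\<in>St n. \<pi> v * trans_rate n x v w)
    = (\<Sum>k<n. \<Sum>v\<in>St n. if v ! k < v ! nxt n k \<and> swap_at n v k = w then \<pi> v * x (v ! k) else 0)"
    unfolding trans_rate_def sum_distrib_left by (subst sum.swap) (auto intro!: sum.cong)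
  also have "\<dots> = (\<Sum>k<n. if w ! nxt n k < w ! k then x (w ! nxt n k) * \<pi> (swap_at n w k) else 0)"
  proof (rule sum.cong)
    fix k assume "k \<in> {..<n}"
    then have k: "k < n" by simp
    have "(\<Sum>v\<in>St n. if v ! k < v ! nxt n k \<and> swap_at n v k = w then \<pi> v * x (v ! k) else 0)
      = (\<Sum>v\<in>St n. if v = swap_at n w k then (if w ! nxt n k < w ! k then x (w ! nxt n k) * \<pi> (swap_at n w k) else 0) else 0)"
    proof (rule sum.cong)
      fix v assume "v \<in> St n"
      then have "length v = n" by (simp add: St_def)
      then have "swap_at n v k = w \<longleftrightarrow> v = swap_at n w k"
        using swap_at_swap_at[OF assms(1) _ k] len by metis
      then show "(if v ! k < v ! nxt n k \<and> swap_at n v k = w then \<pi> v * x (v ! k) else 0)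
        = (if v = swap_at n w k then (if w ! nxt n k < w ! k then x (w ! nxt n k) * \<pi> (swap_at n w k) else 0) else 0)"
        using nth_swap_at[OF assms(1) len k] by auto
    qed simp
    also have "\<dots> = (if w ! nxt n k < w ! k then x (w ! nxt n k) * \<pi> (swap_at n w k) else 0)"
      using St_swap_at[OF assms(3) k] by (simp add: finite_St)
    finally show "(\<Sum>v\<in>St n. if v ! k < v ! nxt n k \<and> swap_at n v k = w then \<pi> v * x (v ! k) else 0) = \<dots>" .
  qed simp
  finally have "\<pi> w * out_rate n x w = \<dots>" using assms by (simp add: stationary_def)
  moreover have "\<pi> w * out_rate n x w = (\<Sum>k<n. if w ! k < w ! nxt n k then x (w ! k) * \<pi> w else 0)"
    unfolding out_rate_def sum_distrib_left by (intro sum.cong) auto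
  ultimately show ?thesis unfolding gen_bottom_def sum_subtractf by simp
qed

text \<open>With \<open>f = G / F\<close>, both balance equations give that the Dirichlet form
  \<open>\<Sum> F(v) rate(v, w) (f v - f w)\<^sup>2\<close> vanishes.\<close>
lemma balance_ratio_swap:
  assumes n: "2 \<le> n" and x: "\<forall>i\<in>{1..n}. x i > 0" and F: "\<forall>w\<in>St n. F w > 0"
    and bF: "\<forall>w\<in>St n. gen_bottom x n F w = 0" and bG: "\<forall>w\<in>St n. gen_bottom x n G w = 0"
    and w: "w \<in> St n" and k: "k < n" and desc: "w ! nxt n k < w ! k"
  shows "G (swap_at n w k) / F (swap_at n w k) = G w / F w"
proof -
  define f where "f w = G w / F w" for w
  define c where "c w k = (if w ! nxt n k < w ! k then x (w ! nxt n k) * F (swap_at n w k) else 0)" for w k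
  define out where "out w = (\<Sum>k<n. if w ! k < w ! nxt n k then x (w ! k) else 0)" for w
  have xpos: "x (w ! i) > 0" if "w \<in> St n" "i < n" for w i
    using x that nth_mem[of i w] by (auto simp: St_def)
  have len: "length w = n" if "w \<in> St n" for w using that by (simp add: St_def)
  have G: "G w = f w * F w" if "w \<in> St n" for w using F that by (force simp: f_def)
  have c_nonneg: "c w k \<ge> 0" if "w \<in> St n" "k < n" for w k
    using F St_swap_at[OF that] xpos[OF that(1) nxt_less[OF that(2)]] by (auto simp: c_def intro!: mult_nonneg_nonneg less_imp_le)
  have in_F: "(\<Sum>k<n. c w k) = F w * out w" if "w \<in> St n" for w
  proof -
    have "F w * out w = (\<Sum>k<n. if w ! k < w ! nxt n k then x (w ! k) * F w else 0)"
      unfolding out_def sum_distrib_left by (intro sum.cong) auto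
    moreover have "gen_bottom x n F w = 0" using bF that by blast
    ultimately show ?thesis unfolding gen_bottom_def sum_subtractf c_def by linarith
  qed
  have in_G: "(\<Sum>k<n. c w k * f (swap_at n w k)) = f w * F w * out w" if "w \<in> St n" for w
  proof -
    have "f w * F w * out w = (\<Sum>k<n. if w ! k < w ! nxt n k then x (w ! k) * G w else 0)"
      unfolding out_def sum_distrib_left G[OF that] by (intro sum.cong) auto
    moreover have "(\<Sum>k<n. c w k * f (swap_at n w k)) = (\<Sum>k<n. if w ! nxt n k < w ! k then x (w ! nxt n k) * G (swap_at n w k) else 0)"
      using G[OF St_swap_at[OF that]] by (intro sum.cong) (auto simp: c_def)
    moreover have "gen_bottom x n G w = 0" using bG that by blast
    ultimately show ?thesis unfolding gen_bottom_def sum_subtractf by linarith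
  qed
  have sq: "(\<Sum>w\<in>St n. \<Sum>k<n. c w k * (f (swap_at n w k))\<^sup>2) = (\<Sum>w\<in>St n. (f w)\<^sup>2 * (F w * out w))"
  proof -
    have "(\<Sum>w\<in>St n. c w k * (f (swap_at n w k))\<^sup>2)
        = (\<Sum>w\<in>St n. (f w)\<^sup>2 * (F w * (if w ! k < w ! nxt n k then x (w ! k) else 0)))" if "k < n" for k
      by (rule sum.reindex_bij_witness[where i = "\<lambda>u. swap_at n u k" and j = "\<lambda>u. swap_at n u k"])
        (use n that in \<open>simp_all add: c_def swap_at_swap_at nth_swap_at len St_swap_at\<close>)
    then have "(\<Sum>k<n. \<Sum>w\<in>St n. c w k * (f (swap_at n w k))\<^sup>2)
        = (\<Sum>k<n. \<Sum>w\<in>St n. (f w)\<^sup>2 * (F w * (if w ! k < w ! nxt n k then x (w ! k) else 0)))"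
      by simp
    then show ?thesis unfolding out_def sum_distrib_left by (simp only: sum.swap[of _ "St n"])
  qed
  \<comment> \<open>Expanding the square, \<open>in_G\<close> evaluates the mixed term and
    \<open>in_F\<close> the last one; together they give minus the right-hand side of
    \<open>sq\<close>.\<close>
  have "(\<Sum>w\<in>St n. \<Sum>k<n. c w k * (f (swap_at n w k) - f w)\<^sup>2)
      = (\<Sum>w\<in>St n. (\<Sum>k<n. c w k * (f (swap_at n w k))\<^sup>2) - 2 * f w * (\<Sum>k<n. c w k * f (swap_at n w k)) + (f w)\<^sup>2 * (\<Sum>k<n. c w k))"
    unfolding sum_distrib_left sum_subtractf[symmetric] sum.distrib[symmetric]
    by (intro sum.cong) (auto simp: power2_eq_square algebra_simps)
  also have "\<dots> = (\<Sum>w\<in>St n. (\<Sum>k<n. c w k * (f (swap_at n w k))\<^sup>2) - (f w)\<^sup>2 * (F w * out w))"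
    by (intro sum.cong refl) (simp add: in_F in_G power2_eq_square algebra_simps)
  also have "\<dots> = 0" using sq by (simp add: sum_subtractf)
  finally have zero: "(\<Sum>w\<in>St n. \<Sum>k<n. c w k * (f (swap_at n w k) - f w)\<^sup>2) = 0" .
  have "(\<Sum>k<n. c w k * (f (swap_at n w k) - f w)\<^sup>2) = 0"
    using zero w by (subst (asm) sum_nonneg_eq_0_iff) (auto simp: finite_St c_nonneg intro!: sum_nonneg mult_nonneg_nonneg)
  then have "c w k * (f (swap_at n w k) - f w)\<^sup>2 = 0"
    using k w by (subst (asm) sum_nonneg_eq_0_iff) (auto simp: c_nonneg)
  moreover have "c w k > 0"
    using desc F St_swap_at[OF w k] xpos[OF w nxt_less[OF k]] by (simp add: c_def)
  ultimately show ?thesis by (simp add: f_def)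
qed

text \<open>Exchanging an adjacent descent keeps the ratio and makes the word lexicographically
  smaller, so every state is joined to the sorted one.\<close>

lemma balance_unique:
  assumes n: "2 \<le> n" and x: "\<forall>i\<in>{1..n}. x i > 0" and F: "\<forall>w\<in>St n. F w > 0"
    and bF: "\<forall>w\<in>St n. gen_bottom x n F w = 0" and bG: "\<forall>w\<in>St n. gen_bottom x n G w = 0"
    and w: "w \<in> St n"
  shows "G w / F w = G [1..<n+1] / F [1..<n+1]"
  using w
proof (induction w rule: wf_induct_rule[OF wf_lex[OF wf_less_than]])
  case (1 w)
  then have w: "length w = n" "distinct w" "set w = {1..n}" by (auto simp: St_def)
  show ?case
  proof (cases "sorted w")
    case True
    then have "w = [1..<n+1]" using w by (intro sorted_distinct_set_unique) (simp_all add: atLeastLessThanSuc_atLeastAtMost del: upt_Suc)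
    then show ?thesis by (simp only:)
  next
    case False
    then obtain k where k: "Suc k < n" "w ! Suc k < w ! k"
      using w by (auto simp: sorted_iff_nth_Suc not_le)
    have nk: "nxt n k = Suc k" using k by (simp add: nxt_def)
    define p a b q where "p = take k w" and "a = w ! k" and "b = w ! Suc k" and "q = drop (Suc (Suc k)) w"
    have wk: "w = p @ a # b # q"
      using k w by (simp add: p_def a_def b_def q_def Cons_nth_drop_Suc)
    have ab: "b < a" using k by (simp add: a_def b_def)
    have "length p = k" using k w by (simp add: p_def)
    then have "swap_at n w k = p @ b # a # q"
      unfolding swap_at_def nk a_def[symmetric] b_def[symmetric]
      by (subst wk) (simp add: list_update_append)
    then have "(swap_at n w k, w) \<in> lex less_than"
      using ab unfolding wk by (simp add: lex_append_leftI)
    moreover have "swap_at n w k \<in> St n" using St_swap_at 1 k by simp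
    ultimately have "G (swap_at n w k) / F (swap_at n w k) = G [1..<n+1] / F [1..<n+1]" by (rule 1(1))
    moreover have "G (swap_at n w k) / F (swap_at n w k) = G w / F w"
      using 1(2) k nk by (intro balance_ratio_swap[OF n x F bF bG]) auto
    ultimately show ?thesis by (simp del: upt_Suc)
  qed
qed

lemma psi_eq:
  assumes n: "2 \<le> n" and x: "\<forall>i\<in>{1..n}. x i > 0" and F: "\<forall>w\<in>St n. F w > 0"
    and bF: "\<forall>w\<in>St n. gen_bottom x n F w = 0" and id: "F [1..<n+1] = psi_id n x"
    and st: "stationary n x \<pi>" and w: "w \<in> St n"
  shows "psi n x \<pi> w = F w"
proof -
  define c where "c = \<pi> [1..<n+1] / F [1..<n+1]"
  have "\<pi> v / F v = c" if "v \<in> St n" for v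
    unfolding c_def using that stationary_balance[OF n st] by (intro balance_unique[OF n x F bF]) auto
  then have c: "\<pi> v = c * F v" if "v \<in> St n" for v using F that by (force simp: field_simps)
  have "c \<noteq> 0"
  proof
    assume "c = 0"
    then have "(\<Sum>v\<in>St n. \<pi> v) = 0" using c by simp
    then show False using st by (simp add: stationary_def)
  qed
  have idS: "[1..<n+1] \<in> St n" by (auto simp: St_def)
  then have "F [1..<n+1] > 0" using F by blast
  then show ?thesis using c[OF w] c[OF idS] \<open>c \<noteq> 0\<close> unfolding psi_def id[symmetric] by simp
qed

section \<open>Deleting and inserting the smallest class\<close>

lemma run_length: "run r ws us Q = Some p \<Longrightarrow> length ws = length us"
  by (induction r ws us Q arbitrary: p rule: run.induct) (auto split: option.splits)

lemma run_append:
  "length ws = length us \<Longrightarrow>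
   run r (ws @ ws') (us @ us') Q = (case run r ws' us' Q of None \<Rightarrow> None
      | Some (Q1, M1) \<Rightarrow> (case run r ws us Q1 of None \<Rightarrow> None | Some (Q2, M2) \<Rightarrow> Some (Q2, M2 + M1)))"
proof (induction ws us rule: list_induct2)
  case Nil
  then show ?case by (auto split: option.splits)
next
  case (Cons w ws u us)
  then show ?case by (auto simp: Let_def split: option.splits)
qed

lemma run_append_Some:
  "length ws = length us \<Longrightarrow>
   run r (ws @ ws') (us @ us') Q = Some (Q', M) \<longleftrightarrow>
     (\<exists>Q1 M1 M2. run r ws' us' Q = Some (Q1, M1) \<and> run r ws us Q1 = Some (Q', M2) \<and> M = M2 + M1)"
  by (auto simp: run_append split: option.splits)

lemma run_sets:
  "run r ws us Q = Some (Q', M) \<Longrightarrow> set_mset Q' \<subseteq> set_mset Q \<union> set us \<and> set_mset M \<subseteq> insert r (set_mset Q \<union> set us)"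
proof (induction r ws us Q arbitrary: Q' M rule: run.induct)
  case (2 r w ws u us Q)
  then obtain Q1 M1 where 1: "run r ws us Q = Some (Q1, M1)" by (auto split: option.splits)
  have "set_mset (arrive r u Q1) \<subseteq> insert u (set_mset Q1)" by (auto simp: arrive_def)
  moreover have "front r (arrive r u Q1) \<in> insert r (set_mset (arrive r u Q1))"
    unfolding front_def by (rule Min_in) auto
  ultimately show ?case using 2 1 by (fastforce simp: Let_def split: if_splits dest: in_diffD)
qed auto

lemma front_min: "c \<le> r \<Longrightarrow> \<forall>q\<in>#Q. c \<le> q \<Longrightarrow> front r (add_mset c Q) = c"
  unfolding front_def by (rule Min_eqI) auto

definition arrivals :: "nat \<Rightarrow> nat list \<Rightarrow> nat multiset" where
  "arrivals r us = mset (filter (\<lambda>u. u < r) us)"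

lemma run_holes_all:
  "\<exists>M. run r (replicate (length us) (Suc r)) us Q = Some (Q + arrivals r us, M) \<and> size M = length us"
proof (induction us)
  case (Cons u us)
  then obtain M where "run r (replicate (length us) (Suc r)) us Q = Some (Q + arrivals r us, M)" "size M = length us"
    by blast
  then show ?case by (simp add: Let_def arrivals_def arrive_def)
qed (simp add: arrivals_def)

lemma arrive_class: "arrive r a (add_mset c Q) = add_mset c (arrive r a Q)"
  by (auto simp: arrive_def)

lemma run_class_waits:
  assumes "c < r" "\<forall>q\<in>#Q. c < q" "\<forall>u\<in>set A. c < u"
  shows "run r (replicate (Suc (length A)) (Suc r)) (A @ [c]) Q
    = Some (add_mset c (Q + arrivals r A), replicate_mset (Suc (length A)) c)"
  using assms
proof (induction A)
  case Nil
  then show ?case using front_min[of c r Q] by (auto simp: Let_def arrive_def arrivals_def less_imp_le)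
next
  case (Cons a A)
  have "front r (arrive r a (add_mset c (Q + arrivals r A))) = c"
  proof -
    have "\<forall>q\<in>#arrive r a (Q + arrivals r A). c \<le> q"
      using Cons.prems by (auto simp: arrivals_def arrive_def less_imp_le)
    then show ?thesis using front_min[of c r "arrive r a (Q + arrivals r A)"] Cons.prems
      by (simp add: arrive_class)
  qed
  then show ?case using Cons by (simp add: Let_def arrive_def arrivals_def)
qed

text \<open>Class \<open>c\<close> arrives at the right end below everything else and stays in front
  over all holes until it is served at the left end. The letters of \<open>A\<close> pile up behind
  it.\<close>

lemma run_class_block:
  assumes "c < r" "\<forall>q\<in>#Q. c < q" "\<forall>u\<in>set A. c < u"
  shows "run r (c # replicate (length A) (Suc r)) (A @ [c]) Q = Some (Q + arrivals r A, replicate_mset (length A) c)"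
proof (cases A)
  case Nil
  then show ?thesis using front_min[of c r Q] assms by (auto simp: Let_def arrive_def arrivals_def less_imp_le)
next
  case (Cons a B)
  have "front r (arrive r a (add_mset c (Q + arrivals r B))) = c"
  proof -
    have "\<forall>q\<in>#arrive r a (Q + arrivals r B). c \<le> q"
      using assms Cons by (auto simp: arrivals_def arrive_def less_imp_le)
    then show ?thesis using front_min[of c r "arrive r a (Q + arrivals r B)"] assms Cons
      by (simp add: arrive_class)
  qed
  then show ?thesis using run_class_waits[of c r Q B] assms Cons
    by (simp add: Let_def arrive_def arrivals_def)
qed

text \<open>The block of \<open>c\<close> leaves the same queue, \<open>Q1 + arrivals r A\<close>,
  as bare holes below \<open>A\<close>, so the sites to its left do not notice the deletion. Only
  the classes recorded at the \<open>length A\<close> holes of the block change, and of these just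
  the number matters later.\<close>

lemma class_delete:
  assumes len: "length X = length X2" "length Y = length Y2"
    and c: "c < r" "\<forall>u\<in>set X2 \<union> set A \<union> set Y2. c < u"
    and run: "run r (X @ c # replicate (length A) (Suc r) @ Y) (X2 @ A @ c # Y2) {#} = Some ({#}, M)"
  shows "\<exists>M0 MA. M = M0 + replicate_mset (length A) c \<and> size MA = length A \<and> c \<notin># M0 \<and>
    run r (X @ replicate (length A) (Suc r) @ Y) (X2 @ A @ Y2) {#} = Some ({#}, M0 + MA)"
proof -
  let ?H = "replicate (length A) (Suc r)"
  have "run r (X @ (c # ?H) @ Y) (X2 @ (A @ [c]) @ Y2) {#} = Some ({#}, M)" using run by simp
  then obtain Q2 M12 M3 where 12: "run r ((c # ?H) @ Y) ((A @ [c]) @ Y2) {#} = Some (Q2, M12)"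
    and 3: "run r X X2 Q2 = Some ({#}, M3)" and M3: "M = M3 + M12"
    unfolding run_append_Some[OF len(1)] by blast
  have "length (c # ?H) = length (A @ [c])" by simp
  from 12[unfolded run_append_Some[OF this]] obtain Q1 M1 M2 where 1: "run r Y Y2 {#} = Some (Q1, M1)"
    and 2: "run r (c # ?H) (A @ [c]) Q1 = Some (Q2, M2)" and "M12 = M2 + M1"
    by blast
  then have M: "M = M3 + (M2 + M1)" using M3 by simp
  have Q1: "\<forall>q\<in>#Q1. c < q" using run_sets[OF 1] c by auto
  have Q2: "Q2 = Q1 + arrivals r A" "M2 = replicate_mset (length A) c"
    using run_class_block[OF c(1) Q1, of A] 2 c by auto
  obtain MA where MA: "run r ?H A Q1 = Some (Q2, MA)" "size MA = length A"
    using run_holes_all[of r A Q1] Q2 by auto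
  have "run r (?H @ Y) (A @ Y2) {#} = Some (Q2, MA + M1)"
    using 1 MA by (subst run_append_Some) (simp, blast)
  then have "run r (X @ ?H @ Y) (X2 @ A @ Y2) {#} = Some ({#}, M3 + (MA + M1))"
    using 3 unfolding run_append_Some[OF len(1)] by blast
  moreover have "c \<notin># M3 + M1"
  proof -
    have "\<forall>q\<in>#Q2. c < q" using Q1 Q2 c by (auto simp: arrivals_def)
    then have "c \<notin># M3" "c \<notin># M1" using run_sets[OF 1] run_sets[OF 3] c by blast+
    then show ?thesis by simp
  qed
  ultimately show ?thesis using M Q2 MA
    by (intro exI[of _ "M3 + M1"] exI[of _ MA]) (simp add: ac_simps)
qed

text \<open>Converse of \<open>class_delete\<close>: any run of holes in the bottom line can be
  chosen as the block that \<open>c\<close> crosses, whatever larger classes stand above it.\<close>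

lemma class_insert:
  assumes len: "length X = length X2" "length Y = length Y2"
    and c: "c < r" "\<forall>u\<in>set X2 \<union> set A \<union> set Y2. c < u"
    and run: "run r (X @ replicate (length A) (Suc r) @ Y) (X2 @ A @ Y2) {#} = Some ({#}, M)"
  shows "\<exists>M0 MA. M = M0 + MA \<and> size MA = length A \<and> c \<notin># M0 \<and>
    run r (X @ c # replicate (length A) (Suc r) @ Y) (X2 @ A @ c # Y2) {#} = Some ({#}, M0 + replicate_mset (length A) c)"
proof -
  let ?H = "replicate (length A) (Suc r)"
  obtain Q2 M12 M3 where 12: "run r (?H @ Y) (A @ Y2) {#} = Some (Q2, M12)"
    and 3: "run r X X2 Q2 = Some ({#}, M3)" and M3: "M = M3 + M12"
    using run unfolding run_append_Some[OF len(1)] by blast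
  have "length ?H = length A" by simp
  from 12[unfolded run_append_Some[OF this]] obtain Q1 M1 M2 where 1: "run r Y Y2 {#} = Some (Q1, M1)"
    and 2: "run r ?H A Q1 = Some (Q2, M2)" and "M12 = M2 + M1"
    by blast
  then have M: "M = M3 + (M2 + M1)" using M3 by simp
  have Q1: "\<forall>q\<in>#Q1. c < q" using run_sets[OF 1] c by auto
  have Q2: "Q2 = Q1 + arrivals r A" "size M2 = length A"
    using run_holes_all[of r A Q1] 2 by auto
  have "run r (c # ?H) (A @ [c]) Q1 = Some (Q2, replicate_mset (length A) c)"
    using run_class_block[OF c(1) Q1, of A] c Q2 by simp
  then have "run r ((c # ?H) @ Y) ((A @ [c]) @ Y2) {#} = Some (Q2, replicate_mset (length A) c + M1)"
    using 1 by (subst run_append_Some) (simp, blast)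
  then have "run r (X @ (c # ?H) @ Y) (X2 @ (A @ [c]) @ Y2) {#} = Some ({#}, M3 + (replicate_mset (length A) c + M1))"
    using 3 unfolding run_append_Some[OF len(1)] by blast
  moreover have "c \<notin># M3 + M1"
  proof -
    have "\<forall>q\<in>#Q2. c < q" using Q1 Q2 c by (auto simp: arrivals_def)
    then have "c \<notin># M3" "c \<notin># M1" using run_sets[OF 1] run_sets[OF 3] c by blast+
    then show ?thesis by simp
  qed
  ultimately show ?thesis using M Q2
    by (intro exI[of _ "M3 + M1"] exI[of _ M2]) (simp add: ac_simps)
qed

text \<open>While \<open>c\<close> is in front, a site is a hole or serves \<open>c\<close>, and the
  empty final queue forces the service to occur. The induction takes sites off the right end, the
  order of processing.\<close>

lemma waiting_class_served:
  assumes "run r V U (add_mset c Q) = Some ({#}, M)" "c < r" "\<forall>q\<in>#Q. c < q" "\<forall>u\<in>set U. c < u"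
  shows "\<exists>X e X2 a A. V = X @ c # replicate e (Suc r) \<and> U = X2 @ a # A \<and> length A = e"
  using assms
proof (induction V arbitrary: U Q M rule: rev_induct)
  case Nil
  then show ?case using run_length[OF Nil.prems(1)] by simp
next
  case (snoc z V)
  then obtain U' u where U: "U = U' @ [u]" using run_length[OF snoc.prems(1)] by (cases U rule: rev_cases) auto
  have len: "length V = length U'" using run_length[OF snoc.prems(1)] U by simp
  obtain Q1 M1 M2 where 1: "run r [z] [u] (add_mset c Q) = Some (Q1, M1)" and 2: "run r V U' Q1 = Some ({#}, M2)"
    using snoc.prems(1) unfolding U run_append_Some[OF len] by blast
  have Q: "arrive r u (add_mset c Q) = add_mset c (arrive r u Q)" by (auto simp: arrive_def)
  have Q': "\<forall>q\<in>#arrive r u Q. c < q" using snoc.prems U by (auto simp: arrive_def)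
  then have f: "front r (add_mset c (arrive r u Q)) = c" using snoc.prems by (intro front_min) (auto simp: less_imp_le)
  show ?case
  proof (cases "z = Suc r")
    case True
    then have "Q1 = add_mset c (arrive r u Q)" using 1 by (simp add: Let_def Q)
    then obtain X e X2 a A where "V = X @ c # replicate e (Suc r)" "U' = X2 @ a # A" "length A = e"
      using snoc.IH[of U' "arrive r u Q" M2] 2 Q' snoc.prems U by auto
    then show ?thesis using True U
      by (intro exI[of _ X] exI[of _ "Suc e"] exI[of _ X2] exI[of _ a] exI[of _ "A @ [u]"])
        (simp add: replicate_append_same)
  next
    case False
    then have "z = c" using 1 by (auto simp: Let_def Q f split: if_splits)
    then show ?thesis using U by (intro exI[of _ V] exI[of _ 0] exI[of _ U'] exI[of _ u] exI[of _ "[]"]) simp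
  qed
qed

lemma class_extract:
  assumes run: "run r ws us {#} = Some ({#}, M)" and c: "c < r" "count_list us c = 1" "\<forall>u\<in>set us. c \<le> u"
  obtains X X2 A Y Y2 where "ws = X @ c # replicate (length A) (Suc r) @ Y" "us = X2 @ A @ c # Y2"
    "length X = length X2" "length Y = length Y2"
proof -
  have len: "length ws = length us" using run_length[OF run] .
  have "c \<in> set us" using c by (metis count_notin zero_neq_one)
  then obtain U Y2 where us: "us = U @ c # Y2" by (auto simp: in_set_conv_decomp)
  then have cnt: "c \<notin> set U" "c \<notin> set Y2" using c by (auto simp: count_list_0_iff)
  define W where "W = take (length U) ws"
  define Y where "Y = drop (Suc (length U)) ws"
  define z where "z = ws ! length U"
  have "ws = W @ z # Y"
    unfolding W_def z_def Y_def by (rule id_take_nth_drop) (use len us in simp)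
  then have ws: "ws = (W @ [z]) @ Y" by simp
  have lens: "length W = length U" "length Y = length Y2"
    using len us by (simp_all add: W_def Y_def)
  have "length (W @ [z]) = length (U @ [c])" using lens by simp
  note split = run_append_Some[OF this, of r Y Y2 "{#}" "{#}" M]
  have "us = (U @ [c]) @ Y2" using us by simp
  then have "run r ((W @ [z]) @ Y) ((U @ [c]) @ Y2) {#} = Some ({#}, M)" using run ws by metis
  then obtain Q1 M1 M2 where 1: "run r Y Y2 {#} = Some (Q1, M1)" and 2: "run r (W @ [z]) (U @ [c]) Q1 = Some ({#}, M2)"
    unfolding split by blast
  obtain Q2 M3 M4 where 3: "run r [z] [c] Q1 = Some (Q2, M3)" and 4: "run r W U Q2 = Some ({#}, M4)"
    using 2 unfolding run_append_Some[OF lens(1)] by blast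
  have gt: "c < u" if "u \<in> set U \<union> set Y2" for u
    using that c(3) cnt unfolding us by (cases "u = c") (auto simp: order_less_le)
  have Q1: "\<forall>q\<in>#Q1. c < q" using run_sets[OF 1] gt by auto
  have f: "front r (add_mset c Q1) = c" using Q1 c by (intro front_min) (auto simp: less_imp_le)
  show ?thesis
  proof (cases "z = Suc r")
    case True
    then have "Q2 = add_mset c Q1" using 3 c by (simp add: Let_def arrive_def)
    then obtain X e X2 a A where "W = X @ c # replicate e (Suc r)" "U = X2 @ a # A" "length A = e"
      using waiting_class_served[of r W U c Q1 M4] 4 Q1 c(1) gt by blast
    moreover from this have "length X = length X2" using lens by simp
    ultimately show ?thesis using ws us True lens
      by (intro that[of X "a # A" Y X2 Y2]) (simp_all add: replicate_app_Cons_same)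
  next
    case False
    then have "z = c" using 3 c by (auto simp: Let_def arrive_def f split: if_splits)
    then show ?thesis using ws us lens by (intro that[of W "[]" Y U Y2]) simp_all
  qed
qed

section \<open>Cyclic walks and cut lines\<close>

definition gap :: "nat list \<Rightarrow> nat \<Rightarrow> nat \<Rightarrow> nat" where
  "gap l a b = (if index l a < index l b then index l b - index l a - 1
     else length l + index l b - index l a - 1)"

text \<open>Once the letters below \<open>j\<close> are dropped, every letter strictly between \<open>j + 1\<close> and \<open>j\<close>
  exceeds \<open>j + 1\<close>.\<close>
definition legs :: "nat \<Rightarrow> nat \<Rightarrow> nat list \<Rightarrow> nat" where
  "legs k r l = (\<Sum>j\<in>{k..<r}. gap (filter (\<lambda>y. j \<le> y) l) (Suc j) j)"

lemma legs_filter_less: "j < k \<Longrightarrow> legs k r (P @ j # R) = legs k r (P @ R)"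
  unfolding legs_def by (intro sum.cong refl) simp

lemma legs_empty [simp]: "r \<le> k \<Longrightarrow> legs k r l = 0"
  by (simp add: legs_def)

lemma legs_step:
  assumes "k < r" "\<forall>y\<in>set l. k \<le> y"
  shows "legs k r l = gap l (Suc k) k + legs (Suc k) r l"
proof -
  have "filter (\<lambda>y. k \<le> y) l = l" using assms by (simp add: filter_id_conv)
  then show ?thesis using assms(1) by (simp add: legs_def sum.atLeast_Suc_lessThan)
qed

lemma index_insert:
  "a \<noteq> c \<Longrightarrow> index (P @ c # R) a = (if index (P @ R) a < length P then index (P @ R) a else Suc (index (P @ R) a))"
  using index_less[of a P] by (auto simp: index_append index_Cons)

lemma index_decomp: "a \<notin> set P \<Longrightarrow> index (P @ a # R) a = length P"
  by (simp add: index_append index_Cons)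

text \<open>A bottom word after the cut: the served \<open>r\<close> is removed, the classes below
  \<open>k\<close> are deleted, and \<open>Suc r\<close> marks holes.\<close>

definition bottom_line :: "nat \<Rightarrow> nat \<Rightarrow> nat list \<Rightarrow> bool" where
  "bottom_line k r ws \<longleftrightarrow> set ws \<subseteq> insert (Suc r) {k..<r} \<and> (\<forall>j\<in>{k..<r}. count_list ws j = 1)"

text \<open>Here \<open>r\<close> is the hole of the upper word, so its multiplicity is left
  free.\<close>

definition top_line :: "nat \<Rightarrow> nat \<Rightarrow> nat list \<Rightarrow> bool" where
  "top_line k r us \<longleftrightarrow> set us \<subseteq> {k..r} \<and> (\<forall>j\<in>{k..<r}. count_list us j = 1)"

lemma bottom_line_insert:
  "k < r \<Longrightarrow> bottom_line k r (P @ k # R) \<longleftrightarrow> k \<notin> set P \<and> k \<notin> set R \<and> bottom_line (Suc k) r (P @ R)"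
proof -
  assume kr: "k < r"
  have "(\<forall>j\<in>{k..<r}. count_list (P @ k # R) j = 1) \<longleftrightarrow>
     (k \<notin> set P \<and> k \<notin> set R) \<and> (\<forall>j\<in>{Suc k..<r}. count_list (P @ R) j = 1)"
  proof -
    have "{k..<r} = insert k {Suc k..<r}" using kr by auto
    then show ?thesis by (auto simp: count_list_0_iff)
  qed
  moreover have "insert (Suc r) {k..<r} = insert k (insert (Suc r) {Suc k..<r})" using kr by auto
  ultimately show ?thesis unfolding bottom_line_def by (auto 5 0)
qed

lemma top_line_insert:
  "k < r \<Longrightarrow> top_line k r (P @ k # R) \<longleftrightarrow> k \<notin> set P \<and> k \<notin> set R \<and> top_line (Suc k) r (P @ R)"
proof -
  assume kr: "k < r"
  have "(\<forall>j\<in>{k..<r}. count_list (P @ k # R) j = 1) \<longleftrightarrow>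
     (k \<notin> set P \<and> k \<notin> set R) \<and> (\<forall>j\<in>{Suc k..<r}. count_list (P @ R) j = 1)"
  proof -
    have "{k..<r} = insert k {Suc k..<r}" using kr by auto
    then show ?thesis by (auto simp: count_list_0_iff)
  qed
  moreover have "{k..r} = insert k {Suc k..r}" using kr by auto
  ultimately show ?thesis unfolding top_line_def by (auto 5 0)
qed

lemma index_le: "index l a \<le> length l"
  by (simp add: index_def length_takeWhile_le)

text \<open>Here \<open>d\<close> and \<open>d'\<close> are the numbers of holes passed by the classes \<open>k\<close> and \<open>k + 1\<close>; the
  inequality is strict only if \<open>k + 1\<close> starts to the right of \<open>k\<close> and ends to its left.\<close>
lemma gap_insert_le:
  assumes t: "index w' (Suc k) = t" "t < T \<or> T + d \<le> t" and w: "w = P @ k # R" "w' = P @ R" "length P = T"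
    and u: "u = PU @ k # RU" "u' = PU @ RU" "length PU = T + d" "index u' (Suc k) = t + d'"
    and k: "k \<notin> set P" "k \<notin> set PU" and len: "length w = length u"
    and r: "r \<noteq> k" "r \<noteq> Suc k"
  shows "gap (r # w) (Suc k) k + d \<le> gap (r # u) (Suc k) k + d'"
    and "t + d' < T + d \<or> T + d \<le> t \<Longrightarrow> gap (r # w) (Suc k) k + d = gap (r # u) (Suc k) k + d'"
proof -
  \<comment> \<open>Positions shift by one for the head \<open>r\<close>, and by one more to the
    right of the inserted \<open>k\<close>.\<close>
  have 1: "index (r # w) k = Suc T" "index (r # u) k = Suc (T + d)"
    using w u k r by (auto simp: index_Cons index_decomp)
  have 2: "index (r # w) (Suc k) = (if t < T then Suc t else Suc (Suc t))"
    using t w r index_insert[of "Suc k" k P R] by (auto simp: index_Cons)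
  have 3: "index (r # u) (Suc k) = (if t + d' < T + d then Suc (t + d') else Suc (Suc (t + d')))"
    using u r index_insert[of "Suc k" k PU RU] by (auto simp: index_Cons)
  have "length u = Suc (length u')" using u by simp
  then have "length w \<ge> T + d + 1" "length w \<ge> t + d' + 1"
    using u len index_le[of u' "Suc k"] by auto
  then show "gap (r # w) (Suc k) k + d \<le> gap (r # u) (Suc k) k + d'"
    "t + d' < T + d \<or> T + d \<le> t \<Longrightarrow> gap (r # w) (Suc k) k + d = gap (r # u) (Suc k) k + d'"
    using t len unfolding gap_def 1 2 3 by (auto split: if_splits)
qed

lemma legs_Cons_step:
  assumes "k < s" "k \<le> r" "\<forall>y\<in>set (P @ R). k \<le> y" "r \<noteq> k"
  shows "legs k s (r # P @ k # R) = gap (r # P @ k # R) (Suc k) k + legs (Suc k) s (r # P @ R)"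
  using legs_step[of k s "r # P @ k # R"] legs_filter_less[of k "Suc k" s "r # P" R] assms by auto

section \<open>Change of the walk length along one link\<close>

lemma bottom_line_last_holes:
  assumes "bottom_line r r ws"
  obtains N where "ws = replicate N (Suc r)"
proof -
  have "ws = replicate (length ws) (Suc r)"
    using assms by (intro replicate_eqI) (auto simp: bottom_line_def)
  then show ?thesis by (rule that)
qed

lemma run_straight_top: "run r (replicate N (Suc r)) (replicate N r) {#} = Some ({#}, replicate_mset N r)"
  by (induction N) (auto simp: Let_def arrive_def)

lemma gap_top_class: "k \<notin> set P \<Longrightarrow> r \<noteq> k \<Longrightarrow> gap (r # P @ k # R) r k = length P"
  by (simp add: gap_def index_Cons index_decomp)

lemma class_extract_line:
  assumes run: "run r ws us {#} = Some ({#}, M)" and k: "k < r" and lines: "bottom_line k r ws" "top_line k r us"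
  obtains X X2 A Y Y2 M0 MA where "ws = X @ k # replicate (length A) (Suc r) @ Y" "us = X2 @ A @ k # Y2"
    "length X = length X2" "length Y = length Y2" "k \<notin> set X" "k \<notin> set (X2 @ A)"
    "bottom_line (Suc k) r (X @ replicate (length A) (Suc r) @ Y)" "top_line (Suc k) r (X2 @ A @ Y2)"
    "M = M0 + replicate_mset (length A) k" "size MA = length A" "k \<notin># M0"
    "run r (X @ replicate (length A) (Suc r) @ Y) (X2 @ A @ Y2) {#} = Some ({#}, M0 + MA)"
proof -
  have 1: "count_list us k = 1" "\<forall>u\<in>set us. k \<le> u" using lines k by (auto simp: top_line_def)
  obtain X X2 A Y Y2 where d: "ws = X @ k # replicate (length A) (Suc r) @ Y" "us = X2 @ A @ k # Y2"
    "length X = length X2" "length Y = length Y2"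
    by (rule class_extract[OF run k 1])
  have b: "k \<notin> set X" "bottom_line (Suc k) r (X @ replicate (length A) (Suc r) @ Y)"
    using lines(1) bottom_line_insert[OF k, of X "replicate (length A) (Suc r) @ Y"] unfolding d(1) by simp_all
  have t: "k \<notin> set (X2 @ A)" "k \<notin> set Y2" "top_line (Suc k) r (X2 @ A @ Y2)"
    using lines(2) top_line_insert[OF k, of "X2 @ A" Y2] unfolding d(2) by simp_all
  have gt: "\<forall>u\<in>set X2 \<union> set A \<union> set Y2. k < u" using t(3) unfolding top_line_def by force
  obtain M0 MA where M: "M = M0 + replicate_mset (length A) k" "size MA = length A" "k \<notin># M0"
    "run r (X @ replicate (length A) (Suc r) @ Y) (X2 @ A @ Y2) {#} = Some ({#}, M0 + MA)"
    using class_delete[OF d(3,4) k gt run[unfolded d(1,2)]] by (elim exE conjE)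
  show ?thesis by (rule that[OF d b(1) t(1) b(2) t(3) M])
qed

text \<open>The head \<open>r\<close> is the site of the cut, restored as the start of the walk.
  After deletion of \<open>k\<close> the bound for \<open>k + 1\<close> has the hole count
  \<open>size M0 + length A - length A'\<close>. By \<open>gap_insert_le\<close> the leg from
  \<open>k + 1\<close> to \<open>k\<close> is longer below than above by at most
  \<open>length A' - length A\<close>. The sum leaves \<open>size M0\<close>, the holes not recorded
  as \<open>k\<close>.\<close>

lemma legs_lower_line:
  assumes "1 \<le> k" "k \<le> r" "bottom_line k r ws" "top_line k r us" "run r ws us {#} = Some ({#}, M)"
  shows "legs k r (r # ws) \<le> legs k (r - 1) (r # us) + (size M - count M k)"
  using assms
proof (induction "r - k" arbitrary: k ws us M)
  case 0
  then show ?case by simp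
next
  case (Suc e)
  then have k: "k < r" by simp
  obtain X X2 A Y Y2 M0 MA where d: "ws = X @ k # replicate (length A) (Suc r) @ Y" "us = X2 @ A @ k # Y2"
    "length X = length X2" "length Y = length Y2" "k \<notin> set X" "k \<notin> set (X2 @ A)"
    and lines: "bottom_line (Suc k) r (X @ replicate (length A) (Suc r) @ Y)" "top_line (Suc k) r (X2 @ A @ Y2)"
    and M: "M = M0 + replicate_mset (length A) k" "size MA = length A" "k \<notin># M0"
    and run: "run r (X @ replicate (length A) (Suc r) @ Y) (X2 @ A @ Y2) {#} = Some ({#}, M0 + MA)"
    by (rule class_extract_line[OF Suc.prems(5) k Suc.prems(3,4)])
  define ws' where "ws' = X @ replicate (length A) (Suc r) @ Y"
  define us' where "us' = X2 @ A @ Y2"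
  have cM: "size M - count M k = size M0" "size (M0 + MA) = size M0 + length A" using M by (auto simp: not_in_iff)
  have geb: "\<forall>y\<in>set ws'. k \<le> y"
    using lines(1) k unfolding bottom_line_def ws'_def[symmetric] by fastforce
  have geu: "\<forall>y\<in>set us'. k \<le> y" using lines(2) by (auto simp: top_line_def us'_def)
  show ?case
  \<comment> \<open>For \<open>k = r - 1\<close> the leg from \<open>r\<close> to \<open>k\<close>
    has no partner in the top line, where \<open>r\<close> is the hole. Without \<open>k\<close> the
    bottom line consists of holes only, so their number bounds the leg.\<close>
  proof (cases "Suc k = r")
    case True
    have "length ws' = size (M0 + MA)"
    proof -
      have "bottom_line r r ws'" using lines(1) True by (simp add: ws'_def)
      then obtain N where "ws' = replicate N (Suc r)" by (rule bottom_line_last_holes)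
      then have "count_list ws' (Suc r) = length ws'" by (induction N arbitrary: ws') auto
      then show ?thesis using run_size[OF run] by (simp add: ws'_def)
    qed
    then have "length X \<le> size M0" using cM by (simp add: ws'_def)
    moreover have "legs k r (r # ws) = length X"
      using legs_Cons_step[of k r r X "replicate (length A) (Suc r) @ Y"] k geb True d gap_top_class[of k X r]
      by (auto simp: ws'_def)
    ultimately show ?thesis using cM by simp
  next
    case False
    then have k1: "Suc k < r" using k by simp
    have IH: "legs (Suc k) r (r # ws') \<le> legs (Suc k) (r - 1) (r # us') + (size (M0 + MA) - count (M0 + MA) (Suc k))"
      using Suc.hyps(2) k unfolding ws'_def us'_def by (intro Suc.hyps(1)[OF _ _ _ lines run]) simp_all
    obtain X' X2' A' Y' Y2' M0' where d': "ws' = X' @ Suc k # replicate (length A') (Suc r) @ Y'"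
      "us' = X2' @ A' @ Suc k # Y2'" "length X' = length X2'" "Suc k \<notin> set X'" "Suc k \<notin> set (X2' @ A')"
      and M': "M0 + MA = M0' + replicate_mset (length A') (Suc k)" "Suc k \<notin># M0'"
      by (rule class_extract_line[OF run k1 lines, folded ws'_def us'_def])
    have c': "count (M0 + MA) (Suc k) = length A'" using M' by (simp add: not_in_iff)
    have i1: "index ws' (Suc k) = length X'" using d' by (simp add: index_decomp)
    have i2: "index us' (Suc k) = length X' + length A'" using d' index_decomp[of "Suc k" "X2' @ A'" Y2'] by simp
    \<comment> \<open>The sites crossed by \<open>k\<close> are holes, so \<open>k + 1\<close>
      cannot sit among them.\<close>
    have t: "length X' < length X \<or> length X + length A \<le> length X'"
    proof (rule ccontr)
      assume "\<not> ?thesis"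
      then have "length X \<le> length X'" "length X' - length X < length A" by linarith+
      then have "ws' ! length X' = Suc r" by (simp add: ws'_def nth_append)
      moreover have "ws' ! length X' = Suc k" using d' by (simp add: nth_append)
      ultimately show False using k by simp
    qed
    have "gap (r # ws) (Suc k) k + length A \<le> gap (r # us) (Suc k) k + length A'"
      by (rule gap_insert_le(1)[OF i1 t, where P = X and R = "replicate (length A) (Suc r) @ Y" and PU = "X2 @ A" and RU = Y2])
        (use d k1 i2 in \<open>auto simp: ws'_def us'_def\<close>)
    moreover have "legs k r (r # ws) = gap (r # ws) (Suc k) k + legs (Suc k) r (r # ws')"
      using legs_Cons_step[of k r r X "replicate (length A) (Suc r) @ Y"] k geb d by (simp add: ws'_def)
    moreover have "legs k (r - 1) (r # us) = gap (r # us) (Suc k) k + legs (Suc k) (r - 1) (r # us')"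
      using legs_Cons_step[of k "r - 1" r "X2 @ A" Y2] k1 geu d by (simp add: us'_def)
    moreover have "length A' \<le> size (M0 + MA)" using c' count_le_size by metis
    ultimately show ?thesis using IH cM c' by simp
  qed
qed

text \<open>Classes \<open>j < k\<close> do not enter the walk. Deleting one keeps the number of
  holes and can only let more of them record \<open>k\<close>, so the bound for the shorter lines is
  the stronger one.\<close>

lemma legs_lower:
  assumes "1 \<le> j" "j \<le> k" "k \<le> r" "bottom_line j r ws" "top_line j r us" "run r ws us {#} = Some ({#}, M)"
  shows "legs k r (r # ws) \<le> legs k (r - 1) (r # us) + (size M - count M k)"
  using assms
proof (induction "k - j" arbitrary: j ws us M)
  case 0
  then show ?case using legs_lower_line by simp
next
  case (Suc e)
  then have j: "j < k" "j < r" by simp_all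
  obtain X X2 A Y Y2 M0 MA where d: "ws = X @ j # replicate (length A) (Suc r) @ Y" "us = X2 @ A @ j # Y2"
    and lines: "bottom_line (Suc j) r (X @ replicate (length A) (Suc r) @ Y)" "top_line (Suc j) r (X2 @ A @ Y2)"
    and M: "M = M0 + replicate_mset (length A) j" "size MA = length A"
    and run: "run r (X @ replicate (length A) (Suc r) @ Y) (X2 @ A @ Y2) {#} = Some ({#}, M0 + MA)"
    by (rule class_extract_line[OF Suc.prems(6) j(2) Suc.prems(4,5)])
  have "legs k r (r # X @ replicate (length A) (Suc r) @ Y)
      \<le> legs k (r - 1) (r # X2 @ A @ Y2) + (size (M0 + MA) - count (M0 + MA) k)"
    using Suc.hyps(2) j by (intro Suc.hyps(1)[OF _ _ _ Suc.prems(3) lines run]) simp_all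
  moreover have "legs k r (r # ws) = legs k r (r # X @ replicate (length A) (Suc r) @ Y)"
    using legs_filter_less[of j k r "r # X"] j d by simp
  moreover have "legs k (r - 1) (r # us) = legs k (r - 1) (r # X2 @ A @ Y2)"
    using legs_filter_less[of j k "r - 1" "r # X2 @ A"] j d by simp
  moreover have "size (M0 + MA) = size M" "count M k \<le> count (M0 + MA) k" using M j by auto
  ultimately show ?case by simp
qed

text \<open>A top line for \<open>k\<close> arises from one for \<open>k + 1\<close> by inserting
  \<open>k\<close>. The freedom is the number \<open>d\<close> of holes it crosses, chosen to make
  \<open>gap_insert_le\<close> an equality.\<close>

lemma legs_attained_line:
  assumes "1 \<le> k" "k \<le> r" "bottom_line k r ws"
  shows "\<exists>us M. top_line k r us \<and> run r ws us {#} = Some ({#}, M) \<and>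
    legs k r (r # ws) = legs k (r - 1) (r # us) + (size M - count M k)"
  using assms
proof (induction "r - k" arbitrary: k ws)
  case 0
  then have "k = r" by simp
  then have "bottom_line r r ws" using 0 by simp
  then obtain N where "ws = replicate N (Suc r)" by (rule bottom_line_last_holes)
  then have "run r ws (replicate N r) {#} = Some ({#}, replicate_mset N r)"
    using run_straight_top by simp
  moreover have "top_line r r (replicate N r)" by (auto simp: top_line_def)
  ultimately show ?case using \<open>k = r\<close>
    by (intro exI[of _ "replicate N r"] exI[of _ "replicate_mset N r"]) simp
next
  case (Suc e)
  then have k: "k < r" by simp
  have "count_list ws k = 1" using Suc.prems k by (simp add: bottom_line_def)
  then have "k \<in> set ws" by (metis count_notin zero_neq_one)
  then obtain P R where ws: "ws = P @ k # R" by (auto simp: in_set_conv_decomp)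
  have line: "bottom_line (Suc k) r (P @ R)" and kP: "k \<notin> set P"
    using Suc.prems(3) bottom_line_insert[OF k, of P R] ws by auto
  have geb: "\<forall>y\<in>set (P @ R). k \<le> y" using line k unfolding bottom_line_def by fastforce
  have lw: "legs k r (r # ws) = gap (r # ws) (Suc k) k + legs (Suc k) r (r # P @ R)"
    using legs_Cons_step[of k r r P R] k geb ws by simp
  show ?case
  proof (cases "Suc k = r")
    case True
    have "bottom_line r r (P @ R)" using line True by simp
    then obtain N where N: "P @ R = replicate N (Suc r)" by (rule bottom_line_last_holes)
    have "\<forall>y\<in>set (P @ R). y = Suc r" unfolding N by simp
    then have "P = replicate (length P) (Suc r)" "R = replicate (length R) (Suc r)"
      by (auto intro!: replicate_eqI)
    then obtain p q where PR: "P = replicate p (Suc r)" "R = replicate q (Suc r)" by blast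
    \<comment> \<open>Starting at the right end, \<open>k\<close> crosses all \<open>q\<close> holes
      to the right of its final site; the \<open>p\<close> holes to the left are exactly the leg
      from \<open>r\<close> to \<open>k\<close>.\<close>
    let ?us = "replicate p r @ replicate q r @ k # []"
    have run: "run r (P @ replicate q (Suc r) @ []) (replicate p r @ replicate q r @ []) {#}
        = Some ({#}, replicate_mset (p + q) r)"
      using run_straight_top[of r "p + q"] unfolding PR(1) by (simp add: replicate_add)
    obtain M0 MA where M: "replicate_mset (p + q) r = M0 + MA" "size MA = q" "k \<notin># M0"
      and run': "run r (P @ k # replicate q (Suc r) @ []) ?us {#} = Some ({#}, M0 + replicate_mset q k)"
    proof -
      have "\<forall>u\<in>set (replicate p r) \<union> set (replicate q r) \<union> set []. k < u" using k by auto
      then show ?thesis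
        using that class_insert[of P "replicate p r" "[]" "[]" k r "replicate q r" "replicate_mset (p + q) r"] run k PR(1)
        by (simp del: append_Nil2) blast
    qed
    have "size M0 = p" using arg_cong[OF M(1), of size] M(2) by simp
    then have "size (M0 + replicate_mset q k) - count (M0 + replicate_mset q k) k = p"
      using M(3) by (simp add: not_in_iff)
    moreover have "legs k r (r # ws) = p"
      using lw True gap_top_class[OF kP, of r R] k ws PR(1) by simp
    moreover have "top_line k r ?us"
      using top_line_insert[OF k, of "replicate p r @ replicate q r" "[]"] k True by (auto simp: top_line_def)
    moreover have "run r ws ?us {#} = Some ({#}, M0 + replicate_mset q k)"
      using run' PR(2) ws by simp
    ultimately show ?thesis using True by (intro exI[of _ ?us] exI[of _ "M0 + replicate_mset q k"]) simp
  next
    case False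
    then have k1: "Suc k < r" using k by simp
    obtain us' M' where u': "top_line (Suc k) r us'" and run: "run r (P @ R) us' {#} = Some ({#}, M')"
      and IH: "legs (Suc k) r (r # P @ R) = legs (Suc k) (r - 1) (r # us') + (size M' - count M' (Suc k))"
    proof -
      have "e = r - Suc k" "1 \<le> Suc k" "Suc k \<le> r" using Suc.hyps(2) k by simp_all
      then show ?thesis using that Suc.hyps(1)[OF _ _ _ line] by blast
    qed
    obtain X' X2' A' Y' Y2' M0' where d': "P @ R = X' @ Suc k # replicate (length A') (Suc r) @ Y'"
      "us' = X2' @ A' @ Suc k # Y2'" "length X' = length X2'" "Suc k \<notin> set X'" "Suc k \<notin> set (X2' @ A')"
      and M': "M' = M0' + replicate_mset (length A') (Suc k)" "Suc k \<notin># M0'"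
      by (rule class_extract_line[OF run k1 line u'])
    have c': "count M' (Suc k) = length A'" using M' by (simp add: not_in_iff)
    have i1: "index (P @ R) (Suc k) = length X'" using d' by (simp add: index_decomp)
    have i2: "index us' (Suc k) = length X' + length A'" using d' index_decomp[of "Suc k" "X2' @ A'" Y2'] by simp
    obtain d Y where R: "R = replicate d (Suc r) @ Y" and t: "length X' < length P \<or> length P + d \<le> length X'"
      and eq: "length X' + length A' < length P + d \<or> length P + d \<le> length X'"
    proof (cases "length X' < length P \<and> length P \<le> length X' + length A'")
      case True
      \<comment> \<open>class \<open>k + 1\<close> would cross class \<open>k\<close>: start \<open>k\<close> just to its right instead\<close>
      define d where "d = length X' + length A' + 1 - length P"
      have d: "length A' - (length P - length X' - 1) = d" using True unfolding d_def by linarith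
      have "R = drop (length P) (X' @ Suc k # replicate (length A') (Suc r) @ Y')"
        unfolding d'(1)[symmetric] by simp
      also have "\<dots> = drop (length P - length X' - 1) (replicate (length A') (Suc r)) @ Y'"
        using True by (simp add: drop_Cons')
      also have "\<dots> = replicate d (Suc r) @ Y'"
        unfolding drop_replicate d ..
      finally show ?thesis using that[of d Y'] True by (simp add: d_def)
    next
      \<comment> \<open>Here the classes do not cross even if \<open>k\<close> goes straight down,
        so \<open>d = 0\<close> works.\<close>
      case False
      then show ?thesis using that[of 0 R] by auto
    qed
    have len: "length us' = length P + d + length Y" using run_length[OF run] R by simp
    define X2 where "X2 = take (length P) us'"
    define A where "A = take d (drop (length P) us')"
    define Y2 where "Y2 = drop (length P + d) us'"
    have us': "us' = X2 @ A @ Y2" unfolding X2_def A_def Y2_def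
      by (metis append_take_drop_id drop_drop add.commute)
    have lens: "length X2 = length P" "length A = d" "length Y2 = length Y"
      using len by (simp_all add: X2_def A_def Y2_def)
    have gt: "\<forall>u\<in>set X2 \<union> set A \<union> set Y2. k < u" using u' us' by (auto simp: top_line_def)
    obtain M0 MA where M: "M' = M0 + MA" "size MA = d" "k \<notin># M0"
      and run': "run r (P @ k # replicate d (Suc r) @ Y) (X2 @ A @ k # Y2) {#} = Some ({#}, M0 + replicate_mset d k)"
      using class_insert[of P X2 Y Y2 k r A M'] run R us' lens k gt by auto
    let ?us = "X2 @ A @ k # Y2"
    have top: "top_line k r ?us" using top_line_insert[OF k, of "X2 @ A" Y2] u' us' gt by auto
    have geu: "\<forall>y\<in>set ((X2 @ A) @ Y2). k \<le> y" using gt by (auto simp: less_imp_le)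
    have "gap (r # ws) (Suc k) k + d = gap (r # ?us) (Suc k) k + length A'"
      by (rule gap_insert_le(2)[OF i1 t, where P = P and R = R and PU = "X2 @ A" and RU = Y2])
        (use ws lens k1 i2 us' kP gt R eq in auto)
    moreover have "legs k (r - 1) (r # ?us) = gap (r # ?us) (Suc k) k + legs (Suc k) (r - 1) (r # us')"
      using legs_Cons_step[of k "r - 1" r "X2 @ A" Y2] k1 geu us' by simp
    moreover have "length A' \<le> size M'" using c' count_le_size by metis
    moreover have "size M' = size M0 + d" using M by simp
    moreover have "size (M0 + replicate_mset d k) - count (M0 + replicate_mset d k) k = size M0"
      using M(3) by (simp add: not_in_iff)
    ultimately have "legs k r (r # ws) = legs k (r - 1) (r # ?us) + (size (M0 + replicate_mset d k) - count (M0 + replicate_mset d k) k)"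
      using lw IH[unfolded c'] by linarith
    then show ?thesis using top run' R ws by blast
  qed
qed

text \<open>A class below \<open>k\<close> is inserted directly above itself and crosses no hole, so
  neither the walk nor the recorded classes change.\<close>

lemma legs_attained:
  assumes "1 \<le> j" "j \<le> k" "k \<le> r" "bottom_line j r ws"
  shows "\<exists>us M. top_line j r us \<and> run r ws us {#} = Some ({#}, M) \<and>
    legs k r (r # ws) = legs k (r - 1) (r # us) + (size M - count M k)"
  using assms
proof (induction "k - j" arbitrary: j ws)
  case 0
  then show ?case using legs_attained_line by simp
next
  case (Suc e)
  then have j: "j < k" "j < r" by simp_all
  have "count_list ws j = 1" using Suc.prems j by (simp add: bottom_line_def)
  then have "j \<in> set ws" by (metis count_notin zero_neq_one)
  then obtain P R where ws: "ws = P @ j # R" by (auto simp: in_set_conv_decomp)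
  have line: "bottom_line (Suc j) r (P @ R)"
    using Suc.prems(4) bottom_line_insert[OF j(2), of P R] ws by auto
  obtain us' M' where u': "top_line (Suc j) r us'" and run: "run r (P @ R) us' {#} = Some ({#}, M')"
    and IH: "legs k r (r # P @ R) = legs k (r - 1) (r # us') + (size M' - count M' k)"
  proof -
    have "e = k - Suc j" "1 \<le> Suc j" "Suc j \<le> k" using Suc.hyps(2) j by simp_all
    then show ?thesis using that Suc.hyps(1)[OF _ _ _ Suc.prems(3) line] by blast
  qed
  define X2 where "X2 = take (length P) us'"
  define Y2 where "Y2 = drop (length P) us'"
  have us': "us' = X2 @ Y2" by (simp add: X2_def Y2_def)
  have lens: "length X2 = length P" "length Y2 = length R"
    using run_length[OF run] by (simp_all add: X2_def Y2_def)
  have gt: "\<forall>u\<in>set X2 \<union> set [] \<union> set Y2. j < u" using u' us' by (auto simp: top_line_def)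
  have run': "run r ws (X2 @ j # Y2) {#} = Some ({#}, M')"
    using class_insert[of P X2 R Y2 j r "[]" M'] run us' lens j gt ws by auto
  have "top_line j r (X2 @ j # Y2)" using top_line_insert[OF j(2), of X2 Y2] u' us' gt by auto
  moreover have "legs k r (r # ws) = legs k r (r # P @ R)"
    using legs_filter_less[of j k r "r # P"] j ws by simp
  moreover have "legs k (r - 1) (r # X2 @ j # Y2) = legs k (r - 1) (r # us')"
    using legs_filter_less[of j k "r - 1" "r # X2" Y2] j us' by simp
  ultimately show ?case using run' IH by metis
qed

section \<open>The largest monomial divisor\<close>

lemma gap_rotate_aux:
  assumes "a \<noteq> b" "count_list (X @ Y) a = 1" "count_list (X @ Y) b = 1"
  shows "gap (Y @ X) a b = gap (X @ Y) a b"
proof -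
  have ex: "c \<in> set X \<and> c \<notin> set Y \<or> c \<notin> set X \<and> c \<in> set Y" if "count_list (X @ Y) c = 1" for c
    using that count_list_0_iff[of X c] count_list_0_iff[of Y c] by (cases "count_list X c = 0") auto
  have ne: "index X a \<noteq> index X b" if "a \<in> set X" "b \<in> set X"
    using that assms(1) nth_index by metis
  have ne': "index Y a \<noteq> index Y b" if "a \<in> set Y" "b \<in> set Y"
    using that assms(1) nth_index by metis
  show ?thesis
    using ex[OF assms(2)] ex[OF assms(3)] index_less[of a X] index_less[of b X] index_less[of a Y] index_less[of b Y] ne ne'
    by (elim disjE) (simp_all add: gap_def index_append add.commute add.left_commute)
qed

lemma count_list_filter: "P a \<Longrightarrow> count_list (filter P l) a = count_list l a"
  by (induction l) auto

lemma gap_filter_rotate: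
  assumes "a \<noteq> b" "count_list l a = 1" "count_list l b = 1" "P a" "P b"
  shows "gap (filter P (rotate m l)) a b = gap (filter P l) a b"
proof -
  let ?i = "m mod length l"
  have l: "filter P l = filter P (take ?i l) @ filter P (drop ?i l)"
    by (metis append_take_drop_id filter_append)
  have "count_list (filter P (take ?i l) @ filter P (drop ?i l)) a = 1"
    "count_list (filter P (take ?i l) @ filter P (drop ?i l)) b = 1"
    unfolding l[symmetric] using assms by (simp_all add: count_list_filter)
  from gap_rotate_aux[OF assms(1) this] show ?thesis
    unfolding rotate_drop_take filter_append l .
qed

lemma legs_rotate:
  assumes "\<forall>j\<in>{k..r}. count_list l j = 1"
  shows "legs k r (rotate m l) = legs k r l"
  unfolding legs_def using assms by (intro sum.cong refl gap_filter_rotate) auto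

lemma words_cut_bottom:
  assumes w: "w \<in> words n r" and r: "1 \<le> r"
  obtains ws where "rotate (index w r) w = r # ws" "bottom_line 1 r ws" "index w r < n"
proof -
  have cnt: "count_list w r = 1" using w r by (simp add: words_def)
  then have "r \<in> set w" by (metis count_notin zero_neq_one)
  then have p: "index w r < length w" "w ! index w r = r" by (simp_all add: index_less nth_index)
  then have "w \<noteq> []" by auto
  then have "hd (rotate (index w r) w) = r" "rotate (index w r) w \<noteq> []" using p by (simp_all add: hd_rotate_conv_nth)
  then obtain ws where ws: "rotate (index w r) w = r # ws" by (cases "rotate (index w r) w") auto
  have c: "count_list (r # ws) j = count_list w j" for j unfolding ws[symmetric] by simp
  have "set (r # ws) = set w" unfolding ws[symmetric] by simp
  moreover have "r \<notin> set ws" using c[of r] cnt by (simp add: count_list_0_iff)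
  ultimately have "set ws \<subseteq> {1..Suc r} - {r}" using w by (auto simp: words_def)
  then have "set ws \<subseteq> insert (Suc r) {1..<r}" by force
  moreover have "count_list ws j = 1" if "j \<in> {1..<r}" for j
    using c[of j] that w by (simp add: words_def)
  ultimately have "bottom_line 1 r ws" by (simp add: bottom_line_def)
  then show ?thesis using that ws p w by (simp add: words_def)
qed

text \<open>At the site of \<open>r\<close> the top letter must be \<open>r\<close> and the queue
  empty, which is the situation on the line. Walk lengths are cyclic, so the cut does not change
  them.\<close>

lemma legs_cut_le:
  assumes w: "w \<in> words n r" and u: "u \<in> words n (r - 1)" and r: "1 \<le> r"
    and run: "cut_run r w u = Some M" and k: "1 \<le> k" "k \<le> r"
  shows "legs k r w \<le> legs k (r - 1) u + (size M - count M k)"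
proof -
  define p where "p = index w r"
  obtain ws where ws: "rotate p w = r # ws" "bottom_line 1 r ws" "p < n"
    unfolding p_def by (rule words_cut_bottom[OF w r])
  have "length (rotate p u) = n" using u by (simp add: words_def)
  then obtain b us where us: "rotate p u = b # us" using ws by (cases "rotate p u") auto
  have setu: "set (b # us) \<subseteq> {1..r}" unfolding us[symmetric] using u r by (simp add: words_def)
  have full: "run r (r # ws) (b # us) {#} = Some ({#}, M)"
    using run ws us unfolding cut_run_def p_def by (auto split: option.splits if_splits)
  then obtain Q1 M1 where 1: "run r ws us {#} = Some (Q1, M1)" by (auto split: option.splits)
  have ok: "queue_ok r Q1" using run_queue_ok[OF 1] setu by (simp add: subset_iff)
  then have okb: "queue_ok r (arrive r b Q1)" using setu by (intro queue_ok_arrive) auto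
  have "front r (arrive r b Q1) = r" "M1 = M"
    using full 1 by (auto simp: Let_def split: if_splits)
  then have "arrive r b Q1 = {#}" using front_eq_top[OF okb] by simp
  then have "Q1 = {#}" "b = r" using setu by (auto simp: arrive_def split: if_splits)
  then have run': "run r ws us {#} = Some ({#}, M)" using 1 \<open>M1 = M\<close> by simp
  have c: "count_list (r # us) j = count_list u j" for j
    using us \<open>b = r\<close> by (metis count_list_rotate)
  have "top_line 1 r us"
    unfolding top_line_def
  proof (intro conjI ballI)
    show "set us \<subseteq> {1..r}" using setu by simp
    fix j assume "j \<in> {1..<r}"
    then show "count_list us j = 1" using c[of j] u by (auto simp: words_def)
  qed
  then have "legs k r (r # ws) \<le> legs k (r - 1) (r # us) + (size M - count M k)"
    using legs_lower[of 1 k r ws us M] ws run' k by simp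
  moreover have "legs k r (r # ws) = legs k r w"
    unfolding ws(1)[symmetric] using w k by (intro legs_rotate) (auto simp: words_def)
  moreover have "legs k (r - 1) (r # us) = legs k (r - 1) u"
    using us \<open>b = r\<close> u k legs_rotate[of k "r - 1" u p] by (auto simp: words_def)
  ultimately show ?thesis by simp
qed

lemma legs_cut_attained:
  assumes w: "w \<in> words n r" and r: "1 \<le> r" and k: "1 \<le> k" "k \<le> r"
  shows "\<exists>u\<in>words n (r - 1). \<exists>M. cut_run r w u = Some M \<and> legs k r w = legs k (r - 1) u + (size M - count M k)"
proof -
  define p where "p = index w r"
  obtain ws where ws: "rotate p w = r # ws" "bottom_line 1 r ws" "p < n"
    unfolding p_def by (rule words_cut_bottom[OF w r])
  obtain us M where us: "top_line 1 r us" and run: "run r ws us {#} = Some ({#}, M)"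
    and eq: "legs k r (r # ws) = legs k (r - 1) (r # us) + (size M - count M k)"
    using legs_attained[of 1 k r ws] ws k by auto
  define u where "u = rotate (n - p) (r # us)"
  have "length (rotate p w) = n" using w by (simp add: words_def)
  then have len: "length (r # us) = n" using run_length[OF run] ws by simp
  have rot_back: "rotate p u = r # us"
    using ws(3) len unfolding u_def rotate_rotate by simp
  have u: "u \<in> words n (r - 1)"
    unfolding words_def
  proof (intro CollectI conjI ballI)
    show "length u = n" using len by (simp add: u_def)
    show "set u \<subseteq> {1..Suc (r - 1)}" using us r by (auto simp: u_def top_line_def)
    fix i assume "i \<in> {1..r - 1}"
    then show "count_list u i = 1" using us unfolding u_def by (auto simp: top_line_def)
  qed
  have "run r (r # ws) (r # us) {#} = Some ({#}, M)"
    using run by (simp add: Let_def arrive_def)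
  then have "cut_run r w u = Some M"
    using ws rot_back by (simp add: cut_run_def p_def[symmetric] del: run.simps)
  moreover have "legs k r (r # ws) = legs k r w"
    unfolding ws(1)[symmetric] using w k by (intro legs_rotate) (auto simp: words_def)
  moreover have "legs k (r - 1) (r # us) = legs k (r - 1) u"
    unfolding rot_back[symmetric] using u k by (intro legs_rotate) (auto simp: words_def)
  ultimately show ?thesis
    using u eq by (intro bexI[OF _ u] exI[of _ M]) simp
qed

lemma mem_sum_mset: "finite A \<Longrightarrow> \<alpha> \<in># (\<Sum>u\<in>A. P u) \<longleftrightarrow> (\<exists>u\<in>A. \<alpha> \<in># P u)"
  by (induction A rule: finite_induct) auto

lemma monomials_Suc_iff:
  "\<alpha> \<in># monomials n (Suc r) w \<longleftrightarrow> (\<exists>u\<in>words n r. \<exists>M \<beta>. cut_run (Suc r) w u = Some M \<and>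
     \<beta> \<in># monomials n r u \<and> \<alpha> = (\<lambda>k. \<beta> k + hole_exponent (Suc r) M k))"
  by (auto simp: mem_sum_mset[OF finite_words] split: option.splits) blast

lemma monomials_support: "\<alpha> \<in># monomials n r w \<Longrightarrow> \<alpha> k \<noteq> 0 \<Longrightarrow> 1 \<le> k \<and> k \<le> r"
proof (induction r arbitrary: w \<alpha>)
  case (Suc r)
  then obtain u M \<beta> where "\<beta> \<in># monomials n r u" "\<alpha> = (\<lambda>k. \<beta> k + hole_exponent (Suc r) M k)"
    unfolding monomials_Suc_iff by blast
  then show ?case using Suc.IH[of \<beta> u] Suc.prems(2)
    by (cases "\<beta> k = 0") (auto simp: hole_exponent_def split: if_splits)
qed simp

lemma monomials_lower:
  "w \<in> words n r \<Longrightarrow> \<alpha> \<in># monomials n r w \<Longrightarrow> 1 \<le> k \<Longrightarrow> legs k r w \<le> \<alpha> k"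
proof (induction r arbitrary: w \<alpha>)
  case (Suc r)
  then obtain u M \<beta> where u: "u \<in> words n r" "cut_run (Suc r) w u = Some M" "\<beta> \<in># monomials n r u"
    and \<alpha>: "\<alpha> = (\<lambda>k. \<beta> k + hole_exponent (Suc r) M k)"
    unfolding monomials_Suc_iff by blast
  show ?case
  proof (cases "k \<le> Suc r")
    case True
    then have "legs k (Suc r) w \<le> legs k r u + (size M - count M k)"
      using legs_cut_le[of w n "Suc r" u M k] Suc.prems u by simp
    then show ?thesis using Suc.IH[OF u(1,3) Suc.prems(3)] True Suc.prems(3) by (simp add: \<alpha> hole_exponent_def)
  qed simp
qed simp

lemma monomials_attained:
  "w \<in> words n r \<Longrightarrow> 1 \<le> k \<Longrightarrow> \<exists>\<alpha>\<in>#monomials n r w. \<alpha> k = legs k r w"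
proof (induction r arbitrary: w)
  case (Suc r)
  \<comment> \<open>For \<open>k > Suc r\<close> walk and exponent are both 0; capping the index
    only serves to obtain some link.\<close>
  define k' where "k' = min k (Suc r)"
  have k': "1 \<le> k'" "k' \<le> Suc r" using Suc.prems by (simp_all add: k'_def)
  obtain u M where u: "u \<in> words n r" "cut_run (Suc r) w u = Some M"
    and eq: "legs k' (Suc r) w = legs k' r u + (size M - count M k')"
    using legs_cut_attained[OF Suc.prems(1) _ k'] by auto
  obtain \<beta> where \<beta>: "\<beta> \<in># monomials n r u" "\<beta> k = legs k r u"
    using Suc.IH[OF u(1) Suc.prems(2)] by blast
  have "(\<lambda>k. \<beta> k + hole_exponent (Suc r) M k) \<in># monomials n (Suc r) w"
    unfolding monomials_Suc_iff using u \<beta> by blast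
  moreover have "\<beta> k + hole_exponent (Suc r) M k = legs k (Suc r) w"
    using \<beta>(2) eq Suc.prems(2) by (cases "k \<le> Suc r") (simp_all add: k'_def hole_exponent_def)
  ultimately show ?case by (intro bexI[of _ "\<lambda>k. \<beta> k + hole_exponent (Suc r) M k"])
qed simp

text \<open>All terms are positive, so one monomial suffices, and \<open>monomials_attained\<close>
  provides it.\<close>

lemma steady_pos:
  assumes "w \<in> words n r" "\<forall>i\<in>{1..n}. x i > 0"
  shows "steady n x r w > 0"
proof -
  have mono: "(\<Prod>k\<in>{1..n}. x k ^ \<alpha> k) > 0" for \<alpha> :: "nat \<Rightarrow> nat"
    using assms(2) by (intro prod_pos) auto
  have nonneg: "(\<Sum>\<alpha>\<in>#P. \<Prod>k\<in>{1..n}. x k ^ \<alpha> k) \<ge> 0" for P :: "(nat \<Rightarrow> nat) multiset"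
    by (induction P) (use mono in \<open>simp_all add: less_imp_le\<close>)
  obtain \<alpha> where "\<alpha> \<in># monomials n r w" using monomials_attained[OF assms(1), of 1] by auto
  then obtain P where P: "monomials n r w = add_mset \<alpha> P" by (metis mset_add)
  show ?thesis unfolding steady_def P using mono[of \<alpha>] nonneg[of P] by simp
qed

section \<open>The statistic \<open>eta\<close> as a walk length\<close>

lemma pos_index: "distinct w \<Longrightarrow> a \<in> set w \<Longrightarrow> pos w a = index w a"
  unfolding pos_def
  by (rule the_equality) (auto simp: index_less nth_index nth_eq_iff_index_eq[symmetric])

text \<open>Rotating \<open>i + 1\<close> to the front turns the letters before \<open>i\<close>
  into a block \<open>B\<close>. It contains neither \<open>i\<close> nor \<open>i + 1\<close>, so
  being at least \<open>i\<close> and exceeding \<open>i + 1\<close> agree on it.\<close>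

lemma a_stat_gap:
  assumes w: "w \<in> St n" and i: "1 \<le> i" "Suc i \<le> n"
  shows "a_stat n w i = gap (filter (\<lambda>y. i \<le> y) w) (Suc i) i"
proof -
  have d: "distinct w" and len: "length w = n" and set: "set w = {1..n}" using w by (auto simp: St_def)
  have mem: "i \<in> set w" "Suc i \<in> set w" using i set by auto
  define p where "p = index w (Suc i)"
  define q where "q = index w i"
  define v where "v = rotate p w"
  have p: "p < n" "w ! p = Suc i" "pos w (i + 1) = p" using mem d len by (auto simp: p_def index_less nth_index pos_index)
  have q: "q < n" "w ! q = i" "pos w i = q" using mem d len by (auto simp: q_def index_less nth_index pos_index)
  have nthv: "v ! e = w ! ((p + e) mod n)" if "e < n" for e using that len by (simp add: v_def nth_rotate)
  have lv: "length v = n" "distinct v" "set v = set w" using len d by (simp_all add: v_def)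
  have "v \<noteq> []" using lv p by auto
  then obtain v' where v': "v = Suc i # v'" using nthv[of 0] p by (cases v) auto
  have "i \<in> set v" using lv mem by simp
  then have "i \<in> set v'" using v' by simp
  then obtain B C where BC: "v' = B @ i # C" by (auto simp: in_set_conv_decomp)
  have v: "v = Suc i # B @ i # C" using v' BC by simp
  define D where "D = (q + n - p) mod n"
  have D: "D < n" using p by (simp add: D_def)
  have "(p + D) mod n = q"
  proof -
    have "(p + D) mod n = (p + (q + n - p)) mod n" unfolding D_def by (rule mod_add_right_eq)
    also have "p + (q + n - p) = q + n" using p by simp
    finally show ?thesis using q by simp
  qed
  then have "v ! D = i" using nthv[OF D] q by simp
  moreover have "v ! Suc (length B) = i" unfolding v by (simp add: nth_append)
  moreover have "Suc (length B) < length v" unfolding v by simp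
  ultimately have DB: "D = Suc (length B)" using lv D nth_eq_iff_index_eq by metis
  have nB: "i \<notin> set B" "Suc i \<notin> set B" using lv(2) unfolding v by auto
  have "a_stat n w i = card {e. 0 < e \<and> e < D \<and> v ! e > i + 1}"
    unfolding a_stat_def p(3) q(3) D_def[symmetric]
    using D nthv by (intro arg_cong[where f = card]) auto
  also have "{e. 0 < e \<and> e < D \<and> v ! e > i + 1} = Suc ` {e. e < length B \<and> B ! e > i + 1}"
  proof (rule set_eqI)
    fix e
    show "e \<in> {e. 0 < e \<and> e < D \<and> v ! e > i + 1} \<longleftrightarrow> e \<in> Suc ` {e. e < length B \<and> B ! e > i + 1}"
      unfolding DB v by (cases e) (auto simp: nth_append)
  qed
  also have "card \<dots> = length (filter (\<lambda>y. y > i + 1) B)"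
    by (subst card_image) (simp_all add: length_filter_conv_card)
  also have "filter (\<lambda>y. y > i + 1) B = filter (\<lambda>y. i \<le> y) B"
  proof (rule filter_cong)
    fix y assume "y \<in> set B"
    then have "y \<noteq> i" "y \<noteq> Suc i" using nB by auto
    then show "y > i + 1 \<longleftrightarrow> i \<le> y" by auto
  qed simp
  also have "length (filter (\<lambda>y. i \<le> y) B) = gap (filter (\<lambda>y. i \<le> y) v) (Suc i) i"
    unfolding v using nB by (simp add: gap_def index_Cons index_append)
  also have "\<dots> = gap (filter (\<lambda>y. i \<le> y) w) (Suc i) i"
  proof -
    have "count_list w a = 1" if "a \<in> set w" for a
      using d that by (simp add: distinct_count_atmost_1 flip: count_mset)
    then show ?thesis unfolding v_def using mem by (intro gap_filter_rotate) auto
  qed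
  finally show ?thesis .
qed

lemma eta_legs:
  assumes "w \<in> St n" "1 \<le> k"
  shows "eta n w k = legs k (n - 1) w"
proof (cases "k \<le> n - 2")
  case True
  then have "eta n w k = (\<Sum>j\<in>{k..n - 2}. a_stat n w j)" using assms(2) by (simp add: eta_def)
  also have "{k..n - 2} = {k..<n - 1}" using True assms(2) by auto
  also have "(\<Sum>j\<in>{k..<n - 1}. a_stat n w j) = legs k (n - 1) w"
    unfolding legs_def using assms by (intro sum.cong refl a_stat_gap) auto
  finally show ?thesis .
next
  case False
  then show ?thesis by (simp add: eta_def)
qed

section \<open>The identity word and the normalisation\<close>

definition sorted_word :: "nat \<Rightarrow> nat \<Rightarrow> nat list" where
  "sorted_word n r = [1..<Suc r] @ replicate (n - r) (Suc r)"

text \<open>Without holes the queue stays empty: an arrival is its own front and must be the class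
  served.\<close>

lemma run_serving:
  "run r cs B {#} = Some (Q, M) \<Longrightarrow> \<forall>c\<in>set cs. c < r \<Longrightarrow> set B \<subseteq> {..r} \<Longrightarrow> B = cs \<and> Q = {#} \<and> M = {#}"
proof (induction cs arbitrary: B Q M)
  case Nil
  then show ?case using run_length[OF Nil(1)] by simp
next
  case (Cons c cs)
  then obtain b B' where B: "B = b # B'" using run_length[OF Cons.prems(1)] by (cases B) auto
  obtain Q1 M1 where 1: "run r cs B' {#} = Some (Q1, M1)" using Cons.prems(1) B by (auto split: option.splits)
  then have IH: "B' = cs" "Q1 = {#}" "M1 = {#}" using Cons.IH[OF 1] Cons.prems B by auto
  have "b \<le> r" using Cons.prems B by simp
  then have "front r (arrive r b {#}) = b" using front_arrive[of b r "{#}"] by simp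
  then show ?case using Cons.prems IH 1 B by (auto simp: Let_def arrive_def split: if_splits)
qed

lemma run_serving_self:
  "\<forall>c\<in>set cs. c < r \<Longrightarrow> run r cs cs {#} = Some ({#}, {#})"
  by (induction cs) (auto simp: Let_def arrive_def front_min)

lemma sorted_word_rotate:
  assumes "1 \<le> r" "r \<le> n"
  shows "rotate (r - 1) (sorted_word n r) = r # replicate (n - r) (Suc r) @ [1..<r]"
    and "rotate (r - 1) (sorted_word n (r - 1)) = r # replicate (n - r) r @ [1..<r]"
    and "index (sorted_word n r) r = r - 1"
proof -
  have 1: "sorted_word n r = [1..<r] @ r # replicate (n - r) (Suc r)"
    using assms by (simp add: sorted_word_def)
  have "n - (r - 1) = Suc (n - r)" using assms by simp
  then have 2: "sorted_word n (r - 1) = [1..<r] @ r # replicate (n - r) r"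
    using assms by (simp add: sorted_word_def)
  show "rotate (r - 1) (sorted_word n r) = r # replicate (n - r) (Suc r) @ [1..<r]"
    unfolding 1 using rotate_append[of "[1..<r]" "r # replicate (n - r) (Suc r)"] by simp
  show "rotate (r - 1) (sorted_word n (r - 1)) = r # replicate (n - r) r @ [1..<r]"
    unfolding 2 using rotate_append[of "[1..<r]" "r # replicate (n - r) r"] by simp
  show "index (sorted_word n r) r = r - 1"
    unfolding 1 by (simp add: index_append index_Cons)
qed

lemma cut_run_sorted_word:
  assumes r: "1 \<le> r" "r \<le> n"
  shows "cut_run r (sorted_word n r) (sorted_word n (r - 1)) = Some (replicate_mset (n - r) r)"
proof -
  have "run r (replicate (n - r) (Suc r) @ [1..<r]) (replicate (n - r) r @ [1..<r]) {#}
      = Some ({#}, replicate_mset (n - r) r)"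
    using run_straight_top[of r "n - r"] run_serving_self[of "[1..<r]" r] by (simp add: run_append)
  then have "run r (r # replicate (n - r) (Suc r) @ [1..<r]) (r # replicate (n - r) r @ [1..<r]) {#}
      = Some ({#}, replicate_mset (n - r) r)"
    by (simp add: Let_def arrive_def)
  then show ?thesis unfolding cut_run_def sorted_word_rotate[OF r] by simp
qed

text \<open>Seen from the cut, the classes \<open>1, ..., r - 1\<close> form the right end and are
  processed first. By \<open>run_serving\<close> they determine the letters above them, and all
  other letters are then \<open>r\<close>.\<close>

lemma cut_run_sorted_word_unique:
  assumes r: "1 \<le> r" "r \<le> n" and u: "u \<in> words n (r - 1)" and run: "cut_run r (sorted_word n r) u = Some M"
  shows "u = sorted_word n (r - 1)"
proof -
  have lu: "length u = n" using u by (simp add: words_def)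
  define v where "v = rotate (r - 1) u"
  have lv: "length v = n" using lu by (simp add: v_def)
  have setv: "set v \<subseteq> {1..r}" using u r by (auto simp: v_def words_def)
  have cv: "count_list v j = 1" if "j \<in> {1..<r}" for j using u that by (auto simp: v_def words_def)
  define A where "A = take (Suc (n - r)) v"
  define B where "B = drop (Suc (n - r)) v"
  have v: "v = A @ B" by (simp add: A_def B_def)
  have lens: "length (r # replicate (n - r) (Suc r)) = length A" "length [1..<r] = length B"
    using lv r by (simp_all add: A_def B_def)
  obtain Q where "run r (r # replicate (n - r) (Suc r) @ [1..<r]) v {#} = Some (Q, M)"
    using run unfolding cut_run_def sorted_word_rotate[OF r] v_def by (auto split: option.splits if_splits)
  then have "run r ((r # replicate (n - r) (Suc r)) @ [1..<r]) (A @ B) {#} = Some (Q, M)"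
    by (simp only: v append_Cons)
  then obtain Q1 M1 where "run r [1..<r] B {#} = Some (Q1, M1)"
    unfolding run_append_Some[OF lens(1)] by blast
  moreover have "set B \<subseteq> {..r}" using setv v by force
  ultimately have B: "B = [1..<r]" using run_serving[of r "[1..<r]" B Q1 M1] by simp
  have "a = r" if "a \<in> set A" for a
  proof (rule ccontr)
    assume "a \<noteq> r"
    then have a: "a \<in> {1..<r}" using that setv v by force
    then have "count_list B a \<noteq> 0" "count_list A a \<noteq> 0" using B that by (auto simp: count_list_0_iff)
    then show False using cv[OF a] v by simp
  qed
  then have "A = replicate (Suc (n - r)) r" using lens(1) by (intro replicate_eqI) auto
  then have "v = r # replicate (n - r) r @ [1..<r]" using v B by simp
  then have "rotate (r - 1) u = rotate (r - 1) (sorted_word n (r - 1))"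
    unfolding v_def sorted_word_rotate[OF r] .
  then have "rotate (n - (r - 1)) (rotate (r - 1) u) = rotate (n - (r - 1)) (rotate (r - 1) (sorted_word n (r - 1)))"
    by simp
  moreover have "rotate (n - (r - 1)) (rotate (r - 1) l) = l" if "length l = n" for l :: "nat list"
    using that r unfolding rotate_rotate by simp
  moreover have "length (sorted_word n (r - 1)) = n" using r by (simp add: sorted_word_def)
  ultimately show ?thesis using lu by metis
qed

lemma sorted_word_words: "r \<le> n \<Longrightarrow> sorted_word n r \<in> words n r"
proof -
  assume r: "r \<le> n"
  have "count_list (replicate m a) i = (if a = i then m else 0)" for m a i :: nat by (induction m) auto
  moreover have "count_list [1..<Suc r] i = 1" if "i \<in> {1..r}" for i
  proof -
    have "distinct [1..<Suc r]" "i \<in> set [1..<Suc r]" using that by auto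
    then show ?thesis unfolding distinct_count_atmost_1 count_mset by presburger
  qed
  ultimately show ?thesis using r by (auto simp: words_def sorted_word_def simp del: upt_Suc)
qed

text \<open>Only one link leads from level \<open>s\<close> to level \<open>s + 1\<close>, and all
  its \<open>n - s - 1\<close> holes record class \<open>s + 1\<close>; this contributes that power
  of every \<open>x_k\<close> with \<open>k \<le> s\<close>.\<close>

lemma steady_sorted_word:
  "r \<le> n \<Longrightarrow> steady n x r (sorted_word n r) = (\<Prod>s<r. \<Prod>k\<in>{1..s}. x k ^ (n - s - 1))"
proof (induction r)
  case 0
  then show ?case by (simp add: steady_0)
next
  case (Suc r)
  let ?w = "sorted_word n (Suc r)"
  let ?M = "replicate_mset (n - Suc r) (Suc r)"
  have c: "cut_run (Suc r) ?w (sorted_word n r) = Some ?M"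
    using cut_run_sorted_word[of "Suc r" n] Suc.prems by simp
  have uniq: "cut_run (Suc r) ?w u = None" if "u \<in> words n r" "u \<noteq> sorted_word n r" for u
    using cut_run_sorted_word_unique[of "Suc r" n u] that Suc.prems by (cases "cut_run (Suc r) ?w u") auto
  have "steady n x (Suc r) ?w = (\<Sum>u\<in>words n r. if u = sorted_word n r
      then (\<Prod>k\<in>{1..n}. x k ^ hole_exponent (Suc r) ?M k) * steady n x r (sorted_word n r) else 0)"
    unfolding steady_Suc_raw by (intro sum.cong refl) (simp add: c uniq)
  also have "\<dots> = (\<Prod>k\<in>{1..n}. x k ^ hole_exponent (Suc r) ?M k) * steady n x r (sorted_word n r)"
    using sorted_word_words[of r n] Suc.prems by (simp add: finite_words)
  also have "(\<Prod>k\<in>{1..n}. x k ^ hole_exponent (Suc r) ?M k) = (\<Prod>k\<in>{1..r}. x k ^ (n - r - 1))"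
    using Suc.prems by (intro prod.mono_neutral_cong_right) (auto simp: hole_exponent_def)
  finally show ?case using Suc by (simp add: mult.commute)
qed

lemma psi_id_alt:
  assumes "1 \<le> n"
  shows "psi_id n x = (\<Prod>s<n - 1. \<Prod>k\<in>{1..s}. x k ^ (n - s - 1))"
proof -
  have "psi_id n x = (\<Prod>j\<in>{1..n}. \<Prod>i\<in>{1..n}. if i < j then x i ^ (j - i - 1) else 1)"
    unfolding psi_id_def by (intro prod.cong refl prod.mono_neutral_cong_left) auto
  also have "\<dots> = (\<Prod>i\<in>{1..n}. \<Prod>j\<in>{1..n}. if i < j then x i ^ (j - i - 1) else 1)"
    by (rule prod.swap)
  also have "\<dots> = (\<Prod>i\<in>{1..n}. \<Prod>s<n. if i \<le> s then x i ^ (n - s - 1) else 1)"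
  proof (rule prod.cong)
    fix i assume i: "i \<in> {1..n}"
    have "(\<Prod>j\<in>{1..n}. if i < j then x i ^ (j - i - 1) else 1) = (\<Prod>j\<in>{i<..n}. x i ^ (j - i - 1))"
      using i by (intro prod.mono_neutral_cong_right) auto
    \<comment> \<open>The substitution \<open>s = n + i - j\<close> turns the exponent
      \<open>j - i - 1\<close> into \<open>n - s - 1\<close>.\<close>
    also have "\<dots> = (\<Prod>s\<in>{i..<n}. x i ^ (n - s - 1))"
      by (rule prod.reindex_bij_witness[where i = "\<lambda>s. n + i - s" and j = "\<lambda>j. n + i - j"]) auto
    also have "\<dots> = (\<Prod>s<n. if i \<le> s then x i ^ (n - s - 1) else 1)"
      using i by (intro prod.mono_neutral_cong_left) auto
    finally show "(\<Prod>j\<in>{1..n}. if i < j then x i ^ (j - i - 1) else 1) = \<dots>" .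
  qed simp
  also have "\<dots> = (\<Prod>s<n. \<Prod>i\<in>{1..n}. if i \<le> s then x i ^ (n - s - 1) else 1)"
    by (rule prod.swap)
  also have "\<dots> = (\<Prod>s<n. \<Prod>i\<in>{1..s}. x i ^ (n - s - 1))"
    by (intro prod.cong refl prod.mono_neutral_cong_right) auto
  also have "\<dots> = (\<Prod>s<n - 1. \<Prod>i\<in>{1..s}. x i ^ (n - s - 1))"
    using assms by (cases n) simp_all
  finally show ?thesis .
qed

lemma sum_mset_count: "(\<Sum>\<alpha>\<in>#P. g \<alpha>) = (\<Sum>\<alpha>\<in>set_mset P. real (count P \<alpha>) * g \<alpha>)"
proof (induction P)
  case (add \<beta> P)
  have "(\<Sum>\<alpha>\<in>set_mset (add_mset \<beta> P). real (count (add_mset \<beta> P) \<alpha>) * g \<alpha>)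
    = (\<Sum>\<alpha>\<in>insert \<beta> (set_mset P). real (count P \<alpha>) * g \<alpha> + (if \<alpha> = \<beta> then g \<alpha> else 0))"
    by (intro sum.cong) (auto simp: algebra_simps)
  also have "\<dots> = (\<Sum>\<alpha>\<in>insert \<beta> (set_mset P). real (count P \<alpha>) * g \<alpha>) + g \<beta>"
    by (simp add: sum.distrib)
  also have "(\<Sum>\<alpha>\<in>insert \<beta> (set_mset P). real (count P \<alpha>) * g \<alpha>) = (\<Sum>\<alpha>\<in>set_mset P. real (count P \<alpha>) * g \<alpha>)"
    by (rule sum.mono_neutral_right) (auto simp: not_in_iff)
  finally show ?case using add by simp
qed simp

theorem mainTheorem3:
  fixes n :: nat and w :: "nat list"
  assumes "n \<ge> 3" and "w \<in> St n"
  shows "\<exists>c. is_poly n c \<and>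
           (\<forall>x \<pi>. (\<forall>i\<in>{1..n}. x i > 0) \<longrightarrow> stationary n x \<pi> \<longrightarrow>
                   psi n x \<pi> w = poly_eval n c x) \<and>
           largest_mono_dvd (eta n w) c"
proof -
  define P where "P = monomials n (n - 1) w"
  \<comment> \<open>Coefficients are multiplicities, so nothing cancels and the support is exactly
    the set of terms.\<close>
  define c where "c \<alpha> = real (count P \<alpha>)" for \<alpha>
  have c0: "c \<alpha> \<noteq> 0 \<longleftrightarrow> \<alpha> \<in># P" for \<alpha> by (simp add: c_def)
  have ww: "v \<in> words n (n - 1)" if "v \<in> St n" for v
    using St_subset_words[of n] assms(1) that by auto
  have "is_poly n c"
    unfolding is_poly_def c0 using monomials_support[of _ n "n - 1" w]
    by (fastforce simp: P_def)
  moreover have "psi n x \<pi> w = poly_eval n c x" if x: "\<forall>i\<in>{1..n}. x i > 0" and st: "stationary n x \<pi>" for x \<pi>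
  proof -
    have "[1..<n + 1] = sorted_word n (n - 1)"
      using assms(1) by (simp add: sorted_word_def)
    then have id: "steady n x (n - 1) [1..<n + 1] = psi_id n x"
      using steady_sorted_word[of "n - 1" n x] psi_id_alt[of n x] assms(1) by simp
    have "\<forall>v\<in>St n. gen_bottom x n (steady n x (n - 1)) v = 0"
    proof
      fix v assume "v \<in> St n"
      have "\<forall>i\<in>{1..n}. x i \<noteq> 0" using x by force
      then show "gen_bottom x n (steady n x (n - 1)) v = 0"
        using steady_balance[of n x "n - 1" v] ww[OF \<open>v \<in> St n\<close>] assms(1) by simp
    qed
    then have "psi n x \<pi> w = steady n x (n - 1) w"
      using steady_pos[OF ww x] assms(1) by (intro psi_eq[where F = "steady n x (n - 1)", OF _ x _ _ id st assms(2)]) auto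
    also have "\<dots> = poly_eval n c x"
      unfolding steady_def sum_mset_count P_def[symmetric] poly_eval_def c0 by (simp add: c_def)
    finally show ?thesis .
  qed
  moreover have "largest_mono_dvd (eta n w) c"
    unfolding largest_mono_dvd_def mono_dvd_def c0
  proof (intro conjI allI impI)
    fix \<beta> k assume "\<beta> \<in># P"
    then show "eta n w k \<le> \<beta> k"
      using monomials_lower[OF ww[OF assms(2)], of \<beta> k] eta_legs[OF assms(2), of k]
      by (cases "1 \<le> k") (auto simp: P_def eta_def)
  next
    \<comment> \<open>A common divisor is bounded at each \<open>k\<close> by a term attaining the
      minimum there; for \<open>k = 0\<close> every exponent is 0.\<close>
    fix \<alpha> k assume \<alpha>: "\<forall>\<beta>. \<beta> \<in># P \<longrightarrow> (\<forall>k. \<alpha> k \<le> \<beta> k)"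
    obtain \<beta> where "\<beta> \<in># P" "\<beta> k = eta n w k"
    proof (cases "1 \<le> k")
      case True
      then show ?thesis using that monomials_attained[OF ww[OF assms(2)], of k] eta_legs[OF assms(2), of k]
        by (auto simp: P_def)
    next
      case False
      obtain \<beta> where "\<beta> \<in># P" using monomials_attained[OF ww[OF assms(2)], of 1] by (auto simp: P_def)
      moreover from this have "\<beta> k = 0" using monomials_support[of \<beta> n "n - 1" w k] False by (auto simp: P_def)
      ultimately show ?thesis using that False by (simp add: eta_def)
    qed
    then show "\<alpha> k \<le> eta n w k" using \<alpha> by metis
  qed
  ultimately show ?thesis by blast
qed

end
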